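(* Let $g_0\in\mathcal M(M)$ be such that $P_{rg_0}(g_0)=\Psi(r)\,g_0$ for a function $\Psi$ of $r>0$. Then the $G^P$-length of the curve $g(r)=rg_0$, $r\in[0,1]$, is given by $$\operatorname{Len}_0^1(g)=\sqrt{\dim(M)\operatorname{Vol}(g_0)}\int_0^1\sqrt{\Psi(r)\,r^{\dim(M)/2-2}}\,dr .$$ If $\Psi(r)=O(r^\alpha)$ as $r\searrow0$ for some $\alpha>-\dim(M)/2$, then $\mathbb R_{>0}\,g_0\subset\mathcal M(M)$ is an incomplete metric space under $G^P$. If in addition (i) $P_gh\in\mathbb R\,g_0$ for all $g\in\mathbb R_{>0}g_0$, $h\in\mathbb R\,g_0$, and (ii) $\mathbb R_{>0}\,g_0$ is totally geodesic in $(\mathcal M(M),G^P)$ — equivalently, $(D_{(g,m)}P)(h)$ is $\tilde g^0_2$-normal to $\mathbb R_{>0}g_0$ for all $g\in\mathbb R_{>0}g_0$, $h\in\mathbb R\,g_0$ and all $m\in T_g\mathcal M(M)$ that are $\tilde g^0_2$-normal to $\mathbb R_{>0}g_0$ — then $(\mathcal M(M),G^P)$ is geodesically incomplete.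
   Context: $M$ is a compact smooth manifold. $\mathcal M(M)=\Gamma(S^2_+T^*M)$ is the space of all smooth Riemannian metrics on $M$, an open convex subset of the Fréchet space $\Gamma(S^2T^*M)$ of smooth symmetric $\binom02$-tensor fields, so $T_g\mathcal M(M)=\Gamma(S^2T^*M)$. For symmetric $h,k$: $g^0_2(h,k)=\operatorname{Tr}(g^{-1}hg^{-1}k)$ and $\tilde g^0_2(h,k)=\int_Mg^0_2(h,k)\operatorname{vol}(g)$, where $\operatorname{vol}(g)$ is the volume density; $\operatorname{Vol}(g)=\int_M\operatorname{vol}(g)$. $D_{(g,m)}F$ denotes the directional derivative $\partial_t|_0F(g+tm)$. $P_g:\Gamma(S^2T^*M)\to\Gamma(S^2T^*M)$ is a positive, symmetric, bijective pseudo-differential operator of order $2p\ge0$, depending smoothly on $g$, and $G^P_g(h,k)=\int_M g^0_2(P_gh,k)\operatorname{vol}(g)$ is the induced Riemannian metric on $\mathcal M(M)$. It is assumed that there is an adjoint $(D_{(g,\cdot)}P\,h)^*(k)\in\Gamma(S^2T^*M)$, smooth in $(g,h,k)$ and bilinear in $(h,k)$, with $\int_M g^0_2((D_{(g,m)}P)h,k)\operatorname{vol}(g)=\int_M g^0_2(m,(D_{(g,\cdot)}P\,h)^*(k))\operatorname{vol}(g)$ for all $m$. Geodesics of $G^P$ are the solutions of $$(P_gg_t)_t=\tfrac12(D_{(g,\cdot)}P\,g_t)^*(g_t)+\tfrac14\,g\operatorname{Tr}(g^{-1}P_gg_t\,g^{-1}g_t)+\tfrac12 g_tg^{-1}P_gg_t+\tfrac12P_gg_t\,g^{-1}g_t-\tfrac12\operatorname{Tr}(g^{-1}g_t)P_gg_t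 .$$ Writing this as $g_{tt}=\Gamma_g(g_t,g_t)$ with $\Gamma_g$ symmetric bilinear, $\mathcal N=\mathbb R_{>0}g_0$ is totally geodesic if $\Gamma_g(h,k)\in T_g\mathcal N=\mathbb R g_0$ for all $g\in\mathcal N$, $h,k\in T_g\mathcal N$. Geodesically incomplete means that some geodesic cannot be extended to all times. The distance on $\mathbb R_{>0}g_0$ is the path-length distance of the Riemannian metric obtained by restricting $G^P$ to this one-dimensional submanifold. *)

theory Defs
  imports "HOL-Analysis.Analysis" "HOL-Library.Function_Algebras" "HOL-Library.Landau_Symbols"
begin

section \<open>Smooth maps between open subsets of vector spaces\<close>

fun iter_deriv :: "'d::real_normed_vector list \<Rightarrow> ('d \<Rightarrow> 'b::real_normed_vector) \<Rightarrow> 'd \<Rightarrow> 'b" where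
  "iter_deriv [] f = f"
| "iter_deriv (v # vs) f = (\<lambda>x. frechet_derivative (iter_deriv vs f) (at x) v)"

text \<open>Meaningful for open \<open>S\<close> in a finite-dimensional space: all iterated directional derivatives
  exist and are again differentiable, i.e. the map is of class \<open>C\<^sup>\<infinity>\<close> on \<open>S\<close>.\<close>

definition smooth_on :: "'d::real_normed_vector set \<Rightarrow> ('d \<Rightarrow> 'b::real_normed_vector) \<Rightarrow> bool" where
  "smooth_on S f \<longleftrightarrow> (\<forall>vs. iter_deriv vs f differentiable_on S)"


section \<open>Compact smooth manifolds\<close>

text \<open>A chart is its domain together with its coordinate map; a manifold is given by an atlas
  (not necessarily maximal) on the union of the chart domains, with the topology induced from the
  ambient type. The dimension is \<open>CARD('n) \<ge> 1\<close>.\<close>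

type_synonym ('a, 'n) chart = "'a set \<times> ('a \<Rightarrow> real^'n)"

definition carrier :: "('a, 'n::finite) chart set \<Rightarrow> 'a set" where
  "carrier A = (\<Union>c\<in>A. fst c)"

definition image_of :: "('a, 'n::finite) chart \<Rightarrow> (real^'n) set" where
  "image_of c = snd c ` fst c"

definition chart_inv :: "('a, 'n::finite) chart \<Rightarrow> real^'n \<Rightarrow> 'a" where
  "chart_inv c = inv_into (fst c) (snd c)"

definition compact_manifold :: "('a::t2_space, 'n::finite) chart set \<Rightarrow> bool" where
  "compact_manifold A \<longleftrightarrow>
     carrier A \<noteq> {} \<and> compact (carrier A) \<and>
     (\<forall>c\<in>A. openin (top_of_set (carrier A)) (fst c) \<and> open (image_of c) \<and>
             homeomorphism (fst c) (image_of c) (snd c) (chart_inv c)) \<and>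
     (\<forall>c\<in>A. \<forall>d\<in>A. smooth_on (snd c ` (fst c \<inter> fst d)) (snd d \<circ> chart_inv c))"

definition smooth_fun :: "('a::t2_space, 'n::finite) chart set \<Rightarrow> ('a \<Rightarrow> real) \<Rightarrow> bool" where
  "smooth_fun A f \<longleftrightarrow> (\<forall>c\<in>A. smooth_on (image_of c) (f \<circ> chart_inv c))"


section \<open>Symmetric 2-tensor fields and Riemannian metrics\<close>

text \<open>A \<open>(0,2)\<close>-tensor field is the family of its matrices in the charts, subject to the usual
  transformation law. The values at irrelevant arguments are set to zero, so that equality of
  tensor fields is equality of functions. Addition and subtraction are pointwise
  (\<open>Function_Algebras\<close>).\<close>

type_synonym ('a, 'n) field = "('a, 'n) chart \<Rightarrow> 'a \<Rightarrow> real^'n^'n"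

definition tscale :: "real \<Rightarrow> ('a, 'n::finite) field \<Rightarrow> ('a, 'n) field" (infixr "*\<^sub>T" 75) where
  "r *\<^sub>T h = (\<lambda>c x. r *\<^sub>R h c x)"

definition fmult :: "('a \<Rightarrow> real) \<Rightarrow> ('a, 'n::finite) field \<Rightarrow> ('a, 'n) field" (infixr "\<cdot>\<^sub>T" 75) where
  "f \<cdot>\<^sub>T h = (\<lambda>c x. f x *\<^sub>R h c x)"

text \<open>The field in the coordinates of \<open>c\<close>, extended by zero to the whole coordinate space.\<close>

definition coord :: "('a, 'n::finite) chart \<Rightarrow> ('a, 'n) field \<Rightarrow> real^'n \<Rightarrow> real^'n^'n" where
  "coord c h y = (if y \<in> image_of c then h c (chart_inv c y) else 0)"

definition jacobian_at :: "('a, 'n::finite) chart \<Rightarrow> ('a, 'n) chart \<Rightarrow> 'a \<Rightarrow> real^'n^'n" where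
  "jacobian_at c d x = matrix (frechet_derivative (snd d \<circ> chart_inv c) (at (snd c x)))"

definition sym_fields :: "('a::t2_space, 'n::finite) chart set \<Rightarrow> ('a, 'n) field set" where
  "sym_fields A = {h.
     (\<forall>c x. c \<notin> A \<or> x \<notin> fst c \<longrightarrow> h c x = 0) \<and>
     (\<forall>c\<in>A. \<forall>x\<in>fst c. transpose (h c x) = h c x) \<and>
     (\<forall>c\<in>A. \<forall>d\<in>A. \<forall>x\<in>fst c \<inter> fst d.
        h c x = transpose (jacobian_at c d x) ** h d x ** jacobian_at c d x) \<and>
     (\<forall>c\<in>A. smooth_on (image_of c) (coord c h))}"

definition metrics :: "('a::t2_space, 'n::finite) chart set \<Rightarrow> ('a, 'n) field set" where
  "metrics A = {g \<in> sym_fields A. \<forall>c\<in>A. \<forall>x\<in>fst c. \<forall>v. v \<noteq> 0 \<longrightarrow> v \<bullet> (g c x *v v) > 0}"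

text \<open>The function \<open>Tr(g\<^sup>-\<^sup>1 h g\<^sup>-\<^sup>1 k)\<close>, the function \<open>Tr(g\<^sup>-\<^sup>1 h)\<close> and the field \<open>h g\<^sup>-\<^sup>1 k\<close>.
  The two traces do not depend on the chart used.\<close>

definition chart_at :: "('a, 'n::finite) chart set \<Rightarrow> 'a \<Rightarrow> ('a, 'n) chart" where
  "chart_at A x = (SOME c. c \<in> A \<and> x \<in> fst c)"

definition g02 :: "('a, 'n::finite) chart set \<Rightarrow> ('a, 'n) field \<Rightarrow> ('a, 'n) field \<Rightarrow> ('a, 'n) field \<Rightarrow> 'a \<Rightarrow> real"
  where "g02 A g h k x = (let c = chart_at A x in
     trace (matrix_inv (g c x) ** h c x ** matrix_inv (g c x) ** k c x))"

definition tr :: "('a, 'n::finite) chart set \<Rightarrow> ('a, 'n) field \<Rightarrow> ('a, 'n) field \<Rightarrow> 'a \<Rightarrow> real" where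
  "tr A g h x = (let c = chart_at A x in trace (matrix_inv (g c x) ** h c x))"

definition gprod :: "('a, 'n::finite) field \<Rightarrow> ('a, 'n) field \<Rightarrow> ('a, 'n) field \<Rightarrow> ('a, 'n) field" where
  "gprod g h k = (\<lambda>c x. h c x ** matrix_inv (g c x) ** k c x)"


section \<open>Integration against the volume density\<close>

definition partition_of_unity ::
  "('a::t2_space, 'n::finite) chart set \<Rightarrow> (('a, 'n) chart \<Rightarrow> 'a \<Rightarrow> real) \<Rightarrow> bool" where
  "partition_of_unity A \<rho> \<longleftrightarrow>
     finite {c\<in>A. \<exists>x\<in>carrier A. \<rho> c x \<noteq> 0} \<and>
     (\<forall>c\<in>A. continuous_on (carrier A) (\<rho> c) \<and> (\<forall>x\<in>carrier A. 0 \<le> \<rho> c x) \<and>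
             closure {x\<in>carrier A. \<rho> c x \<noteq> 0} \<subseteq> fst c) \<and>
     (\<forall>x\<in>carrier A. (\<Sum>c | c \<in> A \<and> (\<exists>x\<in>carrier A. \<rho> c x \<noteq> 0). \<rho> c x) = 1)"

text \<open>The integral of \<open>f vol(g)\<close> over the manifold, with \<open>vol(g) = sqrt(det g) dy\<close> in every chart;
  by the change of variables formula it does not depend on the partition of unity.\<close>

definition vol_integral :: "('a::t2_space, 'n::finite) chart set \<Rightarrow> ('a, 'n) field \<Rightarrow> ('a \<Rightarrow> real) \<Rightarrow> real" where
  "vol_integral A g f = (let \<rho> = (SOME \<rho>. partition_of_unity A \<rho>) in
     \<Sum>c | c \<in> A \<and> (\<exists>x\<in>carrier A. \<rho> c x \<noteq> 0).
       LINT y:image_of c|lborel.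
         \<rho> c (chart_inv c y) * f (chart_inv c y) * sqrt (det (coord c g y)))"

definition Vol :: "('a::t2_space, 'n::finite) chart set \<Rightarrow> ('a, 'n) field \<Rightarrow> real" where
  "Vol A g = vol_integral A g (\<lambda>x. 1)"

definition tilde_g02 ::
  "('a::t2_space, 'n::finite) chart set \<Rightarrow> ('a, 'n) field \<Rightarrow> ('a, 'n) field \<Rightarrow> ('a, 'n) field \<Rightarrow> real" where
  "tilde_g02 A g h k = vol_integral A g (g02 A g h k)"


section \<open>Calculus in the Frechet space of symmetric 2-tensor fields\<close>

text \<open>Convergence in the \<open>C\<^sup>\<infinity>\<close> topology: locally uniform convergence of all derivatives in all charts.\<close>

definition field_tendsto ::
  "('a, 'n::finite) chart set \<Rightarrow> ('s \<Rightarrow> ('a, 'n) field) \<Rightarrow> ('a, 'n) field \<Rightarrow> 's filter \<Rightarrow> bool" where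
  "field_tendsto A H h F \<longleftrightarrow>
     (\<forall>c\<in>A. \<forall>K. compact K \<and> K \<subseteq> image_of c \<longrightarrow>
        (\<forall>vs. uniform_limit K (\<lambda>s. iter_deriv vs (coord c (H s))) (iter_deriv vs (coord c h)) F))"

definition has_curve_deriv ::
  "('a::t2_space, 'n::finite) chart set \<Rightarrow> real set \<Rightarrow> (real \<Rightarrow> ('a, 'n) field) \<Rightarrow> ('a, 'n) field \<Rightarrow> real \<Rightarrow> bool"
  where
  "has_curve_deriv A S c d t \<longleftrightarrow> d \<in> sym_fields A \<and>
     field_tendsto A (\<lambda>s. (1 / (s - t)) *\<^sub>T (c s - c t)) d (at t within S)"

definition curve_deriv ::
  "('a::t2_space, 'n::finite) chart set \<Rightarrow> real set \<Rightarrow> (real \<Rightarrow> ('a, 'n) field) \<Rightarrow> real \<Rightarrow> ('a, 'n) field" where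
  "curve_deriv A S c t = (THE d. has_curve_deriv A S c d t)"

text \<open>\<open>S\<close> is a nondegenerate interval. In the next definition \<open>d k\<close> is the \<open>k\<close>-th derivative of the curve.\<close>

definition smooth_curve ::
  "('a::t2_space, 'n::finite) chart set \<Rightarrow> real set \<Rightarrow> (real \<Rightarrow> ('a, 'n) field) \<Rightarrow> bool" where
  "smooth_curve A S c \<longleftrightarrow> (\<forall>t\<in>S. c t \<in> sym_fields A) \<and>
     (\<exists>d. (\<forall>t\<in>S. d 0 t = c t) \<and>
          (\<forall>k. \<forall>t\<in>S. has_curve_deriv A S (d k) (d (Suc k) t) t))"

definition linear_on_fields ::
  "('a::t2_space, 'n::finite) chart set \<Rightarrow> (('a, 'n) field \<Rightarrow> ('a, 'n) field) \<Rightarrow> bool" where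
  "linear_on_fields A T \<longleftrightarrow> T ` sym_fields A \<subseteq> sym_fields A \<and>
     (\<forall>r. \<forall>h\<in>sym_fields A. \<forall>k\<in>sym_fields A. T (r *\<^sub>T h + k) = r *\<^sub>T T h + T k)"

text \<open>Smoothness of \<open>P : metrics A \<times> sym_fields A \<rightarrow> sym_fields A\<close> and of
  \<open>Q : metrics A \<times> sym_fields A \<times> sym_fields A \<rightarrow> sym_fields A\<close> in the sense of convenient
  calculus: smooth curves are mapped to smooth curves.\<close>

definition smooth_operator_field ::
  "('a::t2_space, 'n::finite) chart set \<Rightarrow> (('a, 'n) field \<Rightarrow> ('a, 'n) field \<Rightarrow> ('a, 'n) field) \<Rightarrow> bool" where
  "smooth_operator_field A P \<longleftrightarrow>
     (\<forall>g h. smooth_curve A UNIV g \<and> range g \<subseteq> metrics A \<and> smooth_curve A UNIV h \<longrightarrow>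
            smooth_curve A UNIV (\<lambda>t. P (g t) (h t)))"

definition smooth_bilinear_field ::
  "('a::t2_space, 'n::finite) chart set \<Rightarrow>
   (('a, 'n) field \<Rightarrow> ('a, 'n) field \<Rightarrow> ('a, 'n) field \<Rightarrow> ('a, 'n) field) \<Rightarrow> bool" where
  "smooth_bilinear_field A Q \<longleftrightarrow>
     (\<forall>g\<in>metrics A. \<forall>h\<in>sym_fields A. linear_on_fields A (Q g h) \<and> linear_on_fields A (\<lambda>k. Q g k h)) \<and>
     (\<forall>g h k. smooth_curve A UNIV g \<and> range g \<subseteq> metrics A \<and>
              smooth_curve A UNIV h \<and> smooth_curve A UNIV k \<longrightarrow>
              smooth_curve A UNIV (\<lambda>t. Q (g t) (h t) (k t)))"

text \<open>\<open>(D\<^bsub>(g,m)\<^esub>P) h\<close>.\<close>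

definition dir_deriv ::
  "('a::t2_space, 'n::finite) chart set \<Rightarrow> (('a, 'n) field \<Rightarrow> ('a, 'n) field \<Rightarrow> ('a, 'n) field) \<Rightarrow>
   ('a, 'n) field \<Rightarrow> ('a, 'n) field \<Rightarrow> ('a, 'n) field \<Rightarrow> ('a, 'n) field" where
  "dir_deriv A P g m h = curve_deriv A UNIV (\<lambda>t. P (g + t *\<^sub>T m) h) 0"


section \<open>Pseudo-differential operators on symmetric 2-tensor fields\<close>

text \<open>The symbol class \<open>S\<^sup>m\<close> of type \<open>(1,0)\<close> on \<open>\<real>\<^sup>n \<times> \<real>\<^sup>n\<close>.\<close>

definition symbol :: "real \<Rightarrow> ((real^'n::finite) \<times> (real^'n) \<Rightarrow> complex) \<Rightarrow> bool" where
  "symbol m a \<longleftrightarrow> smooth_on UNIV a \<and>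
     (\<forall>vs ws. \<exists>C. \<forall>x \<xi>.
        norm (iter_deriv (map (\<lambda>v. (v, 0)) vs @ map (\<lambda>w. (0, w)) ws) a (x, \<xi>))
          \<le> C * (1 + norm \<xi>) powr (m - real (length ws)))"

definition fourier :: "(real^'n::finite \<Rightarrow> real) \<Rightarrow> real^'n \<Rightarrow> complex" where
  "fourier u \<xi> = (LINT y|lborel. cis (- (y \<bullet> \<xi>)) * complex_of_real (u y))"

definition Op :: "((real^'n::finite) \<times> (real^'n) \<Rightarrow> complex) \<Rightarrow> (real^'n \<Rightarrow> real) \<Rightarrow> real^'n \<Rightarrow> complex" where
  "Op a u x = complex_of_real (1 / (2 * pi) ^ CARD('n)) *
     (LINT \<xi>|lborel. cis (x \<bullet> \<xi>) * a (x, \<xi>) * fourier u \<xi>)"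

definition supp :: "('a::t2_space, 'n::finite) chart set \<Rightarrow> ('a \<Rightarrow> real) \<Rightarrow> 'a set" where
  "supp A \<phi> = closure {x \<in> carrier A. \<phi> x \<noteq> 0}"

definition cutoff :: "('a::t2_space, 'n::finite) chart set \<Rightarrow> ('a, 'n) chart \<Rightarrow> ('a \<Rightarrow> real) \<Rightarrow> bool" where
  "cutoff A c \<phi> \<longleftrightarrow> smooth_fun A \<phi> \<and> supp A \<phi> \<subseteq> fst c"

text \<open>A linear operator \<open>T\<close> is pseudo-differential of order \<open>m\<close> if its localizations \<open>\<phi> T \<psi>\<close> are
  given by (matrices of) symbols of order \<open>m\<close> when \<open>\<phi>\<close>, \<open>\<psi>\<close> are supported in the same chart, and by
  smooth kernels when the supports are disjoint.\<close>

definition pseudo_differential ::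
  "('a::t2_space, 'n::finite) chart set \<Rightarrow> real \<Rightarrow> (('a, 'n) field \<Rightarrow> ('a, 'n) field) \<Rightarrow> bool" where
  "pseudo_differential A m T \<longleftrightarrow> linear_on_fields A T \<and>
     (\<forall>c\<in>A. \<forall>\<phi> \<psi>. cutoff A c \<phi> \<and> cutoff A c \<psi> \<longrightarrow>
        (\<exists>a :: 'n \<Rightarrow> 'n \<Rightarrow> 'n \<Rightarrow> 'n \<Rightarrow> (real^'n) \<times> (real^'n) \<Rightarrow> complex.
           (\<forall>i j k l. symbol m (a i j k l)) \<and>
           (\<forall>u\<in>sym_fields A. \<forall>x\<in>image_of c. \<forall>i j.
              complex_of_real (coord c (\<phi> \<cdot>\<^sub>T T (\<psi> \<cdot>\<^sub>T u)) x $ i $ j)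
                = (\<Sum>k\<in>UNIV. \<Sum>l\<in>UNIV. Op (a i j k l) (\<lambda>y. coord c (\<psi> \<cdot>\<^sub>T u) y $ k $ l) x)))) \<and>
     (\<forall>c\<in>A. \<forall>d\<in>A. \<forall>\<phi> \<psi>. cutoff A c \<phi> \<and> cutoff A d \<psi> \<and> supp A \<phi> \<inter> supp A \<psi> = {} \<longrightarrow>
        (\<exists>K :: 'n \<Rightarrow> 'n \<Rightarrow> 'n \<Rightarrow> 'n \<Rightarrow> (real^'n) \<times> (real^'n) \<Rightarrow> real.
           (\<forall>i j k l. smooth_on UNIV (K i j k l)) \<and>
           (\<forall>u\<in>sym_fields A. \<forall>x\<in>image_of c. \<forall>i j.
              coord c (\<phi> \<cdot>\<^sub>T T (\<psi> \<cdot>\<^sub>T u)) x $ i $ j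
                = (\<Sum>k\<in>UNIV. \<Sum>l\<in>UNIV.
                     LINT y|lborel. K i j k l (x, y) * coord d (\<psi> \<cdot>\<^sub>T u) y $ k $ l))))"


section \<open>The metric induced by an operator field, and its geodesics\<close>

definition GP ::
  "('a::t2_space, 'n::finite) chart set \<Rightarrow> (('a, 'n) field \<Rightarrow> ('a, 'n) field \<Rightarrow> ('a, 'n) field) \<Rightarrow>
   ('a, 'n) field \<Rightarrow> ('a, 'n) field \<Rightarrow> ('a, 'n) field \<Rightarrow> real" where
  "GP A P g h k = tilde_g02 A g (P g h) k"

definition admissible_operator ::
  "('a::t2_space, 'n::finite) chart set \<Rightarrow> real \<Rightarrow> (('a, 'n) field \<Rightarrow> ('a, 'n) field \<Rightarrow> ('a, 'n) field) \<Rightarrow> bool"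
  where
  "admissible_operator A p P \<longleftrightarrow> p \<ge> 0 \<and> smooth_operator_field A P \<and>
     (\<forall>g\<in>metrics A.
        pseudo_differential A (2 * p) (P g) \<and>
        bij_betw (P g) (sym_fields A) (sym_fields A) \<and>
        (\<forall>h\<in>sym_fields A. \<forall>k\<in>sym_fields A. tilde_g02 A g (P g h) k = tilde_g02 A g h (P g k)) \<and>
        (\<forall>h\<in>sym_fields A. h \<noteq> 0 \<longrightarrow> tilde_g02 A g (P g h) h > 0))"

text \<open>\<open>Adj g h k\<close> stands for \<open>(D\<^bsub>(g,\<cdot>)\<^esub>P h)\<^sup>*(k)\<close>.\<close>

definition is_adjoint ::
  "('a::t2_space, 'n::finite) chart set \<Rightarrow> (('a, 'n) field \<Rightarrow> ('a, 'n) field \<Rightarrow> ('a, 'n) field) \<Rightarrow>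
   (('a, 'n) field \<Rightarrow> ('a, 'n) field \<Rightarrow> ('a, 'n) field \<Rightarrow> ('a, 'n) field) \<Rightarrow> bool" where
  "is_adjoint A P Adj \<longleftrightarrow> smooth_bilinear_field A Adj \<and>
     (\<forall>g\<in>metrics A. \<forall>h\<in>sym_fields A. \<forall>k\<in>sym_fields A. \<forall>m\<in>sym_fields A.
        tilde_g02 A g (dir_deriv A P g m h) k = tilde_g02 A g m (Adj g h k))"

text \<open>The right hand side of the geodesic equation, with \<open>h\<close> in place of \<open>g\<^sub>t\<close>.\<close>

definition geodesic_rhs ::
  "('a::t2_space, 'n::finite) chart set \<Rightarrow> (('a, 'n) field \<Rightarrow> ('a, 'n) field \<Rightarrow> ('a, 'n) field) \<Rightarrow>
   (('a, 'n) field \<Rightarrow> ('a, 'n) field \<Rightarrow> ('a, 'n) field \<Rightarrow> ('a, 'n) field) \<Rightarrow>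
   ('a, 'n) field \<Rightarrow> ('a, 'n) field \<Rightarrow> ('a, 'n) field" where
  "geodesic_rhs A P Adj g h =
     (1/2) *\<^sub>T Adj g h h
     + (1/4) *\<^sub>T (g02 A g (P g h) h \<cdot>\<^sub>T g)
     + (1/2) *\<^sub>T gprod g h (P g h)
     + (1/2) *\<^sub>T gprod g (P g h) h
     - (1/2) *\<^sub>T (tr A g h \<cdot>\<^sub>T P g h)"

definition geodesic ::
  "('a::t2_space, 'n::finite) chart set \<Rightarrow> (('a, 'n) field \<Rightarrow> ('a, 'n) field \<Rightarrow> ('a, 'n) field) \<Rightarrow>
   (('a, 'n) field \<Rightarrow> ('a, 'n) field \<Rightarrow> ('a, 'n) field \<Rightarrow> ('a, 'n) field) \<Rightarrow>
   real set \<Rightarrow> (real \<Rightarrow> ('a, 'n) field) \<Rightarrow> bool" where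
  "geodesic A P Adj I c \<longleftrightarrow> smooth_curve A I c \<and> c ` I \<subseteq> metrics A \<and>
     (\<forall>t\<in>I. has_curve_deriv A I (\<lambda>s. P (c s) (curve_deriv A I c s))
              (geodesic_rhs A P Adj (c t) (curve_deriv A I c t)) t)"

definition geodesically_incomplete ::
  "('a::t2_space, 'n::finite) chart set \<Rightarrow> (('a, 'n) field \<Rightarrow> ('a, 'n) field \<Rightarrow> ('a, 'n) field) \<Rightarrow>
   (('a, 'n) field \<Rightarrow> ('a, 'n) field \<Rightarrow> ('a, 'n) field \<Rightarrow> ('a, 'n) field) \<Rightarrow> bool" where
  "geodesically_incomplete A P Adj \<longleftrightarrow>
     (\<exists>I c. open I \<and> is_interval I \<and> I \<noteq> {} \<and> geodesic A P Adj I c \<and>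
        \<not> (\<exists>c'. geodesic A P Adj UNIV c' \<and> (\<forall>t\<in>I. c' t = c t)))"

text \<open>\<open>\<Gamma>\<^sub>g\<close>: since \<open>(P\<^sub>g g\<^sub>t)\<^sub>t = (D\<^bsub>(g,g\<^sub>t)\<^esub>P) g\<^sub>t + P\<^sub>g g\<^sub>t\<^sub>t\<close>, solving the geodesic equation for \<open>g\<^sub>t\<^sub>t\<close>
  gives the quadratic form \<open>\<Gamma>\<^sub>g(h,h)\<close>, from which \<open>\<Gamma>\<^sub>g\<close> is obtained by polarization.\<close>

definition christoffel_quad ::
  "('a::t2_space, 'n::finite) chart set \<Rightarrow> (('a, 'n) field \<Rightarrow> ('a, 'n) field \<Rightarrow> ('a, 'n) field) \<Rightarrow>
   (('a, 'n) field \<Rightarrow> ('a, 'n) field \<Rightarrow> ('a, 'n) field \<Rightarrow> ('a, 'n) field) \<Rightarrow>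
   ('a, 'n) field \<Rightarrow> ('a, 'n) field \<Rightarrow> ('a, 'n) field" where
  "christoffel_quad A P Adj g h =
     inv_into (sym_fields A) (P g) (geodesic_rhs A P Adj g h - dir_deriv A P g h h)"

definition christoffel ::
  "('a::t2_space, 'n::finite) chart set \<Rightarrow> (('a, 'n) field \<Rightarrow> ('a, 'n) field \<Rightarrow> ('a, 'n) field) \<Rightarrow>
   (('a, 'n) field \<Rightarrow> ('a, 'n) field \<Rightarrow> ('a, 'n) field \<Rightarrow> ('a, 'n) field) \<Rightarrow>
   ('a, 'n) field \<Rightarrow> ('a, 'n) field \<Rightarrow> ('a, 'n) field \<Rightarrow> ('a, 'n) field" where
  "christoffel A P Adj g h k = (1/2) *\<^sub>T
     (christoffel_quad A P Adj g (h + k) - christoffel_quad A P Adj g h - christoffel_quad A P Adj g k)"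


section \<open>The ray through a metric\<close>

definition ray :: "('a, 'n::finite) field \<Rightarrow> ('a, 'n) field set" where
  "ray g0 = {r *\<^sub>T g0 | r. r > 0}"

definition line :: "('a, 'n::finite) field \<Rightarrow> ('a, 'n) field set" where
  "line g0 = {r *\<^sub>T g0 | r. True}"

definition ray_totally_geodesic ::
  "('a::t2_space, 'n::finite) chart set \<Rightarrow> (('a, 'n) field \<Rightarrow> ('a, 'n) field \<Rightarrow> ('a, 'n) field) \<Rightarrow>
   (('a, 'n) field \<Rightarrow> ('a, 'n) field \<Rightarrow> ('a, 'n) field \<Rightarrow> ('a, 'n) field) \<Rightarrow> ('a, 'n) field \<Rightarrow> bool" where
  "ray_totally_geodesic A P Adj g0 \<longleftrightarrow>
     (\<forall>g\<in>ray g0. \<forall>h\<in>line g0. \<forall>k\<in>line g0. christoffel A P Adj g h k \<in> line g0)"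

definition normal_to_ray ::
  "('a::t2_space, 'n::finite) chart set \<Rightarrow> ('a, 'n) field \<Rightarrow> ('a, 'n) field \<Rightarrow> ('a, 'n) field \<Rightarrow> bool" where
  "normal_to_ray A g0 g m \<longleftrightarrow> (\<forall>k\<in>line g0. tilde_g02 A g m k = 0)"

text \<open>The length may be infinite, hence the values in \<open>ennreal\<close>.\<close>

definition curve_length ::
  "('a::t2_space, 'n::finite) chart set \<Rightarrow> (('a, 'n) field \<Rightarrow> ('a, 'n) field \<Rightarrow> ('a, 'n) field \<Rightarrow> real) \<Rightarrow>
   real \<Rightarrow> real \<Rightarrow> (real \<Rightarrow> ('a, 'n) field) \<Rightarrow> ennreal" where
  "curve_length A G a b c =
     (\<integral>\<^sup>+t\<in>{a..b}. ennreal (sqrt (G (c t) (curve_deriv A {a..b} c t) (curve_deriv A {a..b} c t))) \<partial>lborel)"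

text \<open>Path-length distance on the submanifold \<open>N\<close>: the paths stay inside \<open>N\<close>.\<close>

definition path_dist ::
  "('a::t2_space, 'n::finite) chart set \<Rightarrow> (('a, 'n) field \<Rightarrow> ('a, 'n) field \<Rightarrow> ('a, 'n) field \<Rightarrow> real) \<Rightarrow>
   ('a, 'n) field set \<Rightarrow> ('a, 'n) field \<Rightarrow> ('a, 'n) field \<Rightarrow> real" where
  "path_dist A G N g h = enn2real
     (INF c\<in>{c. smooth_curve A {0..1} c \<and> c ` {0..1} \<subseteq> N \<and> c 0 = g \<and> c 1 = h}. curve_length A G 0 1 c)"

definition incomplete_metric_space :: "'b set \<Rightarrow> ('b \<Rightarrow> 'b \<Rightarrow> real) \<Rightarrow> bool" where
  "incomplete_metric_space N d \<longleftrightarrow> Metric_space N d \<and> \<not> Metric_space.mcomplete N d"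

end

theory Submission
  imports Defs
begin

text \<open>On the ray everything is one-dimensional. Let \<open>n\<close> be the dimension. At \<open>r g0\<close> the function
  \<open>Tr(g\<^sup>-\<^sup>1 g0 g\<^sup>-\<^sup>1 g0)\<close> is \<open>n / r\<^sup>2\<close> and the volume density is \<open>r\<^bsup>n/2\<^esup> vol(g0)\<close>. Hence \<open>G\<^sup>P(g0, g0)\<close> at \<open>r g0\<close> is
  \<open>n Vol(g0) \<Psi>(r) r\<^bsup>n/2 - 2\<^esup>\<close> (\<open>GP_ray\<close>). Its square root, called \<open>speed\<close>, is the density of arc length, and the
  length formula follows.

  An antiderivative \<open>W\<close> of \<open>speed\<close> maps the ray isometrically onto the interval \<open>W(0,\<infinity>)\<close>
  (\<open>path_dist_ray\<close>). If \<open>\<Psi> = O(r\<^sup>\<alpha>)\<close> with \<open>\<alpha> > - n/2\<close>, then \<open>speed\<close> is bounded near \<open>0\<close> by a multiple of a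
  power \<open>r\<^sup>\<beta>\<close> with \<open>\<beta> > -1\<close>, so \<open>W\<close> has a finite limit \<open>L\<close> at \<open>0\<close>, and the points \<open>g0 / (k+1)\<close> form a Cauchy
  sequence without limit in the ray.

  On multiples of \<open>g0\<close> all terms of the geodesic equation lie in \<open>\<real> g0\<close> except possibly the adjoint.
  So the ray is totally geodesic iff \<open>(D\<^bsub>(r g0,\<cdot>)\<^esub>P g0)\<^sup>*(g0)\<close> lies in \<open>\<real> g0\<close> for all \<open>r\<close>
  (\<open>totally_geodesic_iff\<close>). By the definition of the adjoint, the normality condition says that this field is
  orthogonal to all fields that are normal to the ray, and the double orthogonal complement of the ray's tangent
  line is the line itself (\<open>double_orthogonal\<close>). So the two conditions agree.

  If they hold, the adjoint is \<open>\<Psi>'(r) g0\<close>, and on the ray the geodesic equation holds for the curve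
  \<open>f(t) g0\<close> with \<open>f\<close> the inverse function of \<open>W\<close>: the ray traversed with unit speed
  (\<open>arc_length_curve_geodesic\<close>). It is defined on the open interval \<open>W(0,\<infinity>)\<close>, whose left end \<open>L\<close> is finite, and
  it tends to the zero tensor there. A geodesic that extends it would be continuous at \<open>L\<close>, with a metric as its
  value: a contradiction.\<close>

section \<open>Tensor fields and their curves\<close>

text \<open>Iterated derivatives at a point of an open set depend only on the germ of the map there. The
  openness matters: coordinate fields are cut off to zero outside the image of their chart, and may
  jump at its boundary.\<close>

lemma iter_deriv_linear_combination:
  assumes "open S" "smooth_on S f" "smooth_on S g" "x \<in> S"
  shows "iter_deriv vs (\<lambda>x. r *\<^sub>R f x + g x) x = r *\<^sub>R iter_deriv vs f x + iter_deriv vs g x"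
    and "iter_deriv vs (\<lambda>x. r *\<^sub>R f x + g x) differentiable (at x)"
proof -
  have df: "(iter_deriv vs f has_derivative frechet_derivative (iter_deriv vs f) (at x)) (at x)"
    if "x \<in> S" "smooth_on S f" for vs x and f :: "'a \<Rightarrow> 'b"
    using that assms(1) unfolding smooth_on_def differentiable_on_def
    by (metis at_within_open frechet_derivative_works)
  have *: "iter_deriv vs (\<lambda>x. r *\<^sub>R f x + g x) x = r *\<^sub>R iter_deriv vs f x + iter_deriv vs g x
      \<and> iter_deriv vs (\<lambda>x. r *\<^sub>R f x + g x) differentiable (at x)" if "x \<in> S" for x
    using that
  proof (induction vs arbitrary: x)
    case Nil
    with df[of x f Nil] df[of x g Nil] assms show ?case
      unfolding differentiable_def iter_deriv.simps
      by (auto intro!: exI derivative_eq_intros)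
  next
    case (Cons v vs)
    have der: "(iter_deriv ws (\<lambda>x. r *\<^sub>R f x + g x) has_derivative
        (\<lambda>v. r *\<^sub>R frechet_derivative (iter_deriv ws f) (at x) v
              + frechet_derivative (iter_deriv ws g) (at x) v)) (at x)"
      if "x \<in> S" "\<And>y. y \<in> S \<Longrightarrow> iter_deriv ws (\<lambda>x. r *\<^sub>R f x + g x) y =
             r *\<^sub>R iter_deriv ws f y + iter_deriv ws g y" for x ws
      by (rule has_derivative_transform_within_open[OF _ assms(1) that(1)])
         (use that assms df in \<open>auto intro!: derivative_eq_intros\<close>)
    have eq: "iter_deriv (v # vs) (\<lambda>x. r *\<^sub>R f x + g x) y =
        r *\<^sub>R iter_deriv (v # vs) f y + iter_deriv (v # vs) g y" if "y \<in> S" for y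
      using frechet_derivative_at[OF der[OF that, of vs]] Cons.IH by (simp add: fun_eq_iff)
    show ?case using eq[OF Cons.prems] der[OF Cons.prems, of "v # vs"] eq
      unfolding differentiable_def by blast
  qed
  from *[OF assms(4)] show "iter_deriv vs (\<lambda>x. r *\<^sub>R f x + g x) x = r *\<^sub>R iter_deriv vs f x + iter_deriv vs g x"
    and "iter_deriv vs (\<lambda>x. r *\<^sub>R f x + g x) differentiable (at x)" by auto
qed

lemma smooth_on_const_zero: "smooth_on S (\<lambda>x. 0)"
proof -
  have "iter_deriv vs (\<lambda>x::'a. 0::'b) = (\<lambda>x. 0)" for vs
    by (induction vs) auto
  then show ?thesis by (simp add: smooth_on_def)
qed

lemma smooth_on_linear_combination:
  assumes "open S" "smooth_on S f" "smooth_on S g"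
  shows "smooth_on S (\<lambda>x. r *\<^sub>R f x + g x)"
  unfolding smooth_on_def
  by (intro allI differentiable_at_imp_differentiable_on iter_deriv_linear_combination(2)[OF assms])

lemma field_apply [simp]:
  "(r *\<^sub>T h) c x = r *\<^sub>R h c x"
  "(h + k) c x = h c x + k c x"
  "(h - k) c x = h c x - k c x"
  "(0::('a,'n::finite) field) c x = 0"
  by (auto simp: tscale_def)

lemma fmult_apply [simp]: "(f \<cdot>\<^sub>T h) c x = f x *\<^sub>R h c x"
  by (simp add: fmult_def)

lemma field_eqI: "(\<And>c x. h c x = k c x) \<Longrightarrow> h = (k::('a,'n::finite) field)"
  by (intro ext)

lemma tscale_algebra:
  fixes h k :: "('a,'n::finite) field"
  shows "r *\<^sub>T s *\<^sub>T h = (r * s) *\<^sub>T h" "1 *\<^sub>T h = h" "0 *\<^sub>T h = 0" "r *\<^sub>T 0 = (0::('a,'n) field)"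
    "r *\<^sub>T h + s *\<^sub>T h = (r + s) *\<^sub>T h" "r *\<^sub>T h - s *\<^sub>T h = (r - s) *\<^sub>T h"
    "r *\<^sub>T (h + k) = r *\<^sub>T h + r *\<^sub>T k" "r *\<^sub>T (h - k) = r *\<^sub>T h - r *\<^sub>T k"
  by (auto intro!: field_eqI simp: algebra_simps)

lemma coord_linear_combination:
  "coord c (r *\<^sub>T h + k) = (\<lambda>y. r *\<^sub>R coord c h y + coord c k y)"
  by (auto simp: coord_def)

lemma transpose_add: "transpose (A + B) = transpose A + transpose B"
  by (simp add: transpose_def vec_eq_iff)

lemma matrix_matrix_mult_scaleR:
  fixes X :: "real^'n^'m" and Y :: "real^'k^'n"
  shows "X ** (r *\<^sub>R Y) = r *\<^sub>R (X ** Y)" "(r *\<^sub>R X) ** Y = r *\<^sub>R (X ** Y)"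
  by (simp_all add: matrix_matrix_mult_def vec_eq_iff sum_distrib_left mult.assoc mult.left_commute)

lemma matrix_sandwich_linear:
  fixes J K X Y :: "real^'n::finite^'n"
  shows "J ** (r *\<^sub>R X + Y) ** K = r *\<^sub>R (J ** X ** K) + J ** Y ** K"
proof -
  have "(B + C) ** K = B ** K + C ** K" for B C :: "real^'n^'n"
    by (simp add: matrix_matrix_mult_def vec_eq_iff sum.distrib distrib_right)
  then show ?thesis
    by (simp add: matrix_add_ldistrib matrix_matrix_mult_scaleR)
qed

locale compact_mfd =
  fixes A :: "('a::t2_space, 'n::finite) chart set"
  assumes compact_manifold: "compact_manifold A"
begin

lemma open_image_of: "c \<in> A \<Longrightarrow> open (image_of c)"
  and openin_domain: "c \<in> A \<Longrightarrow> openin (top_of_set (carrier A)) (fst c)"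
  and chart_homeomorphism: "c \<in> A \<Longrightarrow> homeomorphism (fst c) (image_of c) (snd c) (chart_inv c)"
  and carrier_nonempty: "carrier A \<noteq> {}"
  and compact_carrier: "compact (carrier A)"
  using compact_manifold by (auto simp: compact_manifold_def)

lemma chart_inv_in: "c \<in> A \<Longrightarrow> y \<in> image_of c \<Longrightarrow> chart_inv c y \<in> fst c"
  using chart_homeomorphism[of c] by (auto simp: homeomorphism_def)

lemma chart_inv_cancel: "c \<in> A \<Longrightarrow> x \<in> fst c \<Longrightarrow> chart_inv c (snd c x) = x"
  using chart_homeomorphism[of c] by (auto simp: homeomorphism_def)

lemma chart_in: "c \<in> A \<Longrightarrow> x \<in> fst c \<Longrightarrow> snd c x \<in> image_of c"
  by (auto simp: image_of_def)

lemma domain_subset_carrier: "c \<in> A \<Longrightarrow> x \<in> fst c \<Longrightarrow> x \<in> carrier A"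
  by (auto simp: carrier_def)

lemma coord_chart: "c \<in> A \<Longrightarrow> x \<in> fst c \<Longrightarrow> coord c h (snd c x) = h c x"
  by (simp add: coord_def chart_in chart_inv_cancel)

lemma chart_at: "x \<in> carrier A \<Longrightarrow> chart_at A x \<in> A \<and> x \<in> fst (chart_at A x)"
  unfolding chart_at_def carrier_def by (rule someI_ex) auto

lemma sym_field_smooth: "h \<in> sym_fields A \<Longrightarrow> c \<in> A \<Longrightarrow> smooth_on (image_of c) (coord c h)"
  unfolding sym_fields_def by blast

lemma sym_field_outside: "h \<in> sym_fields A \<Longrightarrow> c \<notin> A \<or> x \<notin> fst c \<Longrightarrow> h c x = 0"
  unfolding sym_fields_def by blast

lemma sym_field_transpose: "h \<in> sym_fields A \<Longrightarrow> c \<in> A \<Longrightarrow> x \<in> fst c \<Longrightarrow> transpose (h c x) = h c x"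
  unfolding sym_fields_def by blast

lemma sym_field_transform:
  "h \<in> sym_fields A \<Longrightarrow> c \<in> A \<Longrightarrow> d \<in> A \<Longrightarrow> x \<in> fst c \<Longrightarrow> x \<in> fst d \<Longrightarrow>
    h c x = transpose (jacobian_at c d x) ** h d x ** jacobian_at c d x"
  unfolding sym_fields_def by blast

lemma sym_fields_linear_combination:
  assumes "h \<in> sym_fields A" "k \<in> sym_fields A"
  shows "r *\<^sub>T h + k \<in> sym_fields A"
  unfolding sym_fields_def mem_Collect_eq coord_linear_combination
proof (intro conjI ballI allI impI)
  fix c d x assume *: "c \<in> A" "d \<in> A" "x \<in> fst c \<inter> fst d"
  show "(r *\<^sub>T h + k) c x =
      transpose (jacobian_at c d x) ** (r *\<^sub>T h + k) d x ** jacobian_at c d x"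
    using sym_field_transform[OF assms(1), of c d x] sym_field_transform[OF assms(2), of c d x] *
    by (simp only: field_apply matrix_sandwich_linear Int_iff)
qed (use assms in \<open>auto simp: sym_field_outside sym_field_transpose transpose_add transpose_scalar
      intro!: smooth_on_linear_combination open_image_of sym_field_smooth\<close>)

lemma zero_in_sym_fields: "0 \<in> sym_fields A"
proof -
  have "coord c 0 = (\<lambda>y. 0)" for c :: "('a,'n) chart" by (auto simp: coord_def)
  moreover have "transpose X ** 0 ** X = 0" for X :: "real^'n^'n"
    by (simp add: vec_eq_iff matrix_matrix_mult_def)
  moreover have "transpose 0 = (0 :: real^'n^'n)" by (simp add: vec_eq_iff transpose_def)
  ultimately show ?thesis
    by (simp add: sym_fields_def smooth_on_const_zero)
qed

lemma sym_fields_scale: "h \<in> sym_fields A \<Longrightarrow> r *\<^sub>T h \<in> sym_fields A"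
  using sym_fields_linear_combination[of h 0 r] zero_in_sym_fields by simp

lemma sym_fields_add: "h \<in> sym_fields A \<Longrightarrow> k \<in> sym_fields A \<Longrightarrow> h + k \<in> sym_fields A"
  using sym_fields_linear_combination[of h k 1] by (simp add: tscale_algebra)

lemma iter_deriv_scale:
  assumes "h \<in> sym_fields A" "c \<in> A" "y \<in> image_of c"
  shows "iter_deriv vs (coord c (r *\<^sub>T h)) y = r *\<^sub>R iter_deriv vs (coord c h) y"
proof -
  have z: "coord c (0::('a,'n) field) = (\<lambda>y. 0)" by (auto simp: coord_def)
  have "iter_deriv vs (\<lambda>y. 0 :: real^'n^'n) = (\<lambda>y::real^'n. 0)"
    by (induction vs) auto
  with iter_deriv_linear_combination(1)[OF open_image_of[OF assms(2)] sym_field_smooth[OF assms(1,2)]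
     sym_field_smooth[OF zero_in_sym_fields assms(2)] assms(3), of vs r]
    coord_linear_combination[of c r h 0]
  show ?thesis by (simp add: z)
qed

lemma field_tendsto_pointwise:
  assumes "field_tendsto A H h F" "c \<in> A" "x \<in> fst c"
  shows "((\<lambda>s. H s c x) \<longlongrightarrow> h c x) F"
proof -
  have "uniform_limit {snd c x} (\<lambda>s. iter_deriv [] (coord c (H s))) (iter_deriv [] (coord c h)) F"
    using assms chart_in unfolding field_tendsto_def by (metis compact_sing empty_subsetI insert_subset)
  then have "((\<lambda>s. coord c (H s) (snd c x)) \<longlongrightarrow> coord c h (snd c x)) F"
    using tendsto_uniform_limitI by force
  then show ?thesis using assms by (simp add: coord_chart)
qed

text \<open>Derivatives in the \<open>C\<^sup>\<infinity>\<close> topology are derivatives of the matrix entries at every point. All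
  information on the derivative of a given curve of fields enters the proof in this form.\<close>

lemma has_curve_deriv_entry:
  assumes "has_curve_deriv A S c d t" "e \<in> A" "x \<in> fst e"
  shows "((\<lambda>s. c s e x $ i $ j) has_real_derivative d e x $ i $ j) (at t within S)"
proof -
  have "((\<lambda>s. ((1 / (s - t)) *\<^sub>T (c s - c t)) e x) \<longlongrightarrow> d e x) (at t within S)"
    using assms field_tendsto_pointwise unfolding has_curve_deriv_def by blast
  then have "((\<lambda>s. ((1 / (s - t)) *\<^sub>T (c s - c t)) e x $ i $ j) \<longlongrightarrow> d e x $ i $ j) (at t within S)"
    by (intro tendsto_vec_nth)
  then show ?thesis by (simp add: has_field_derivative_iff divide_inverse mult.commute)
qed

text \<open>The topology is Hausdorff, so \<^const>\<open>curve_deriv\<close> is evaluated by exhibiting any derivative.\<close>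

lemma has_curve_deriv_unique:
  assumes "has_curve_deriv A S c d t" "has_curve_deriv A S c d' t" "at t within S \<noteq> bot"
  shows "d = d'"
proof (rule field_eqI)
  fix e x
  have d: "d \<in> sym_fields A" "field_tendsto A (\<lambda>s. (1 / (s - t)) *\<^sub>T (c s - c t)) d (at t within S)"
    and d': "d' \<in> sym_fields A" "field_tendsto A (\<lambda>s. (1 / (s - t)) *\<^sub>T (c s - c t)) d' (at t within S)"
    using assms unfolding has_curve_deriv_def by blast+
  show "d e x = d' e x"
  proof (cases "e \<in> A \<and> x \<in> fst e")
    case True
    show ?thesis
      by (rule tendsto_unique[OF assms(3) field_tendsto_pointwise[OF d(2)] field_tendsto_pointwise[OF d'(2)]])
         (use True in auto)
  next
    case False
    then show ?thesis using sym_field_outside[OF d(1), of e x] sym_field_outside[OF d'(1), of e x] by auto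
  qed
qed

lemma curve_deriv_eq:
  assumes "has_curve_deriv A S c d t" "at t within S \<noteq> bot"
  shows "curve_deriv A S c t = d"
  unfolding curve_deriv_def using assms has_curve_deriv_unique by blast

text \<open>On a line \<open>\<real> u\<close> the difference quotients of a curve are real multiples of \<open>u\<close>, so
  convergence of all their derivatives on compact sets reduces to convergence of real difference
  quotients. Only the germ of the curve at \<open>t\<close> is constrained: a line \<open>t \<mapsto> r g0 + t a g0\<close> consists
  of metrics only near \<open>t = 0\<close>.\<close>

lemma has_curve_deriv_scalar:
  assumes "u \<in> sym_fields A" "(\<phi> has_real_derivative D) (at t within S)"
    and ev: "\<forall>\<^sub>F s in at t within S. c s = \<phi> s *\<^sub>T u" and ct: "c t = \<phi> t *\<^sub>T u"
  shows "has_curve_deriv A S c (D *\<^sub>T u) t"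
  unfolding has_curve_deriv_def field_tendsto_def
proof (intro conjI ballI allI impI)
  show "D *\<^sub>T u \<in> sym_fields A" by (rule sym_fields_scale) fact
  fix e K vs assume e: "e \<in> A" and K: "compact K \<and> K \<subseteq> image_of e"
  define q where "q s = (\<phi> s - \<phi> t) / (s - t)" for s
  have q: "(q \<longlongrightarrow> D) (at t within S)"
    using assms(2) by (simp add: q_def[abs_def] has_field_derivative_iff)
  let ?U = "iter_deriv vs (coord e u)"
  have scale: "iter_deriv vs (coord e (a *\<^sub>T u)) y = a *\<^sub>R ?U y" if "y \<in> K" for a y
    using iter_deriv_scale[OF assms(1) e] K that by blast
  have "continuous_on (image_of e) ?U"
    using sym_field_smooth[OF assms(1) e] differentiable_imp_continuous_on
    unfolding smooth_on_def by blast
  then have "compact (?U ` K)"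
    using K continuous_on_subset compact_continuous_image by blast
  then obtain B where B: "B > 0" "\<And>y. y \<in> K \<Longrightarrow> norm (?U y) \<le> B"
    by (metis bounded_pos compact_imp_bounded imageI)
  have "uniform_limit K (\<lambda>s y. q s *\<^sub>R ?U y) (\<lambda>y. D *\<^sub>R ?U y) (at t within S)"
  proof (rule uniform_limitI)
    fix \<epsilon> :: real assume "\<epsilon> > 0"
    then have "\<forall>\<^sub>F s in at t within S. dist (q s) D < \<epsilon> / B"
      using q B(1) by (intro tendstoD) auto
    then show "\<forall>\<^sub>F s in at t within S. \<forall>y\<in>K. dist (q s *\<^sub>R ?U y) (D *\<^sub>R ?U y) < \<epsilon>"
    proof eventually_elim
      case (elim s)
      show ?case
      proof
        fix y assume "y \<in> K"
        have "dist (q s *\<^sub>R ?U y) (D *\<^sub>R ?U y) = dist (q s) D * norm (?U y)"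
          by (simp add: dist_norm flip: scaleR_diff_left)
        also have "\<dots> \<le> dist (q s) D * B"
          using B(2)[OF \<open>y \<in> K\<close>] by (simp add: mult_left_mono)
        also have "\<dots> < \<epsilon>" using elim B(1) by (simp add: field_simps)
        finally show "dist (q s *\<^sub>R ?U y) (D *\<^sub>R ?U y) < \<epsilon>" .
      qed
    qed
  qed
  moreover have "\<forall>\<^sub>F s in at t within S. \<forall>y\<in>K. q s *\<^sub>R ?U y =
      iter_deriv vs (coord e ((1 / (s - t)) *\<^sub>T (c s - c t))) y"
    using ev
  proof eventually_elim
    case (elim s)
    then have "(1 / (s - t)) *\<^sub>T (c s - c t) = q s *\<^sub>T u"
      by (auto intro!: field_eqI simp: ct q_def diff_divide_distrib algebra_simps)
    then show ?case using scale by simp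
  qed
  moreover have "\<And>y. y \<in> K \<Longrightarrow> D *\<^sub>R ?U y = iter_deriv vs (coord e (D *\<^sub>T u)) y"
    using scale by simp
  ultimately show "uniform_limit K (\<lambda>s. iter_deriv vs (coord e ((1 / (s - t)) *\<^sub>T (c s - c t))))
      (iter_deriv vs (coord e (D *\<^sub>T u))) (at t within S)"
    by (rule uniform_limit_cong[THEN iffD1, rotated 2])
qed

end

section \<open>Matrix inverses and positive definite matrices\<close>

lemma matrix_inv_inverse:
  fixes G :: "real^'n::finite^'n"
  assumes "invertible G"
  shows "G ** matrix_inv G = mat 1" "matrix_inv G ** G = mat 1"
proof -
  have "G ** matrix_inv G = mat 1 \<and> matrix_inv G ** G = mat 1"
    unfolding matrix_inv_def by (rule someI_ex) (use assms in \<open>simp add: invertible_def\<close>)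
  then show "G ** matrix_inv G = mat 1" "matrix_inv G ** G = mat 1" by auto
qed

lemma matrix_inv_unique:
  fixes G H :: "real^'n::finite^'n"
  assumes "H ** G = mat 1"
  shows "matrix_inv G = H"
proof -
  have "invertible G" using assms invertible_left_inverse by blast
  then have "matrix_inv G = (H ** G) ** matrix_inv G" "H ** (G ** matrix_inv G) = H"
    using matrix_inv_inverse(1)[of G] assms by simp_all
  then show ?thesis by (simp add: matrix_mul_assoc)
qed

lemma matrix_inv_scaleR:
  fixes G :: "real^'n::finite^'n"
  assumes "invertible G" "r \<noteq> 0"
  shows "matrix_inv (r *\<^sub>R G) = (1 / r) *\<^sub>R matrix_inv G"
  using assms by (intro matrix_inv_unique) (simp add: matrix_matrix_mult_scaleR matrix_inv_inverse)

lemma det_scaleR: "det (r *\<^sub>R G) = r ^ CARD('n) * det (G :: real^'n::finite^'n)"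
proof -
  have "r *\<^sub>R G = matrix ((*\<^sub>R) r) ** G"
    by (simp add: vec_eq_iff matrix_matrix_mult_def matrix_def axis_def if_distrib
        sum.delta if_distribR cong: if_cong)
  then show ?thesis by (simp add: det_mul)
qed

lemma trace_scaleR: "trace (r *\<^sub>R G) = r * trace (G :: real^'n::finite^'n)"
  by (simp add: trace_def sum_distrib_left)

lemma positive_definite_invertible:
  fixes G :: "real^'n::finite^'n"
  assumes "\<And>v. v \<noteq> 0 \<Longrightarrow> v \<bullet> (G *v v) > 0"
  shows "invertible G"
proof -
  have "v = 0" if "G *v v = 0" for v
    using assms[of v] that by (cases "v = 0") auto
  then show ?thesis
    by (simp add: invertible_left_inverse matrix_left_invertible_ker)
qed

text \<open>The segment from the identity to \<open>G\<close> consists of positive definite, hence invertible matrices.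
  The determinant has no zero on it and keeps the sign that it has at the identity.\<close>

lemma positive_definite_det_pos:
  fixes G :: "real^'n::finite^'n"
  assumes pos: "\<And>v. v \<noteq> 0 \<Longrightarrow> v \<bullet> (G *v v) > 0"
  shows "det G > 0"
proof (rule ccontr)
  assume "\<not> det G > 0"
  define H where "H t = (1 - t) *\<^sub>R mat 1 + t *\<^sub>R G" for t
  have "continuous_on {0..1} (\<lambda>t. det (H t))"
    unfolding det_def H_def by (intro continuous_intros)
  moreover have "det (H 1) \<le> 0" "0 \<le> det (H 0)"
    using \<open>\<not> det G > 0\<close> by (auto simp: H_def)
  ultimately obtain t where t: "0 \<le> t" "t \<le> 1" "det (H t) = 0"
    using IVT2'[of "\<lambda>t. det (H t)" 1 0 0] by auto
  have "v \<bullet> (H t *v v) > 0" if "v \<noteq> 0" for v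
  proof -
    have "v \<bullet> (H t *v v) = (1 - t) * (v \<bullet> v) + t * (v \<bullet> (G *v v))"
      by (simp add: H_def matrix_vector_mult_add_rdistrib inner_add_right
          scaleR_matrix_vector_assoc[symmetric])
    moreover have "(1 - t) * (v \<bullet> v) \<ge> 0" "t * (v \<bullet> (G *v v)) \<ge> 0" "v \<bullet> v > 0"
      using t pos[OF that] that by auto
    moreover have "t * (v \<bullet> (G *v v)) > 0" if "t = 1"
      using pos[OF \<open>v \<noteq> 0\<close>] that by auto
    moreover have "(1 - t) * (v \<bullet> v) > 0" if "t \<noteq> 1"
      using that t \<open>v \<bullet> v > 0\<close> by auto
    ultimately show ?thesis by (cases "t = 1") auto
  qed
  then have "invertible (H t)" by (rule positive_definite_invertible)
  then show False using t by (simp add: invertible_det_nz)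
qed

lemma continuous_on_det:
  fixes G :: "'b::topological_space \<Rightarrow> real^'n::finite^'n"
  assumes "continuous_on S G"
  shows "continuous_on S (\<lambda>y. det (G y))"
  unfolding det_def by (intro continuous_intros assms)

lemma continuous_on_matrix_mult:
  fixes X Y :: "'b::topological_space \<Rightarrow> real^'n::finite^'n"
  assumes "continuous_on S X" "continuous_on S Y"
  shows "continuous_on S (\<lambda>y. X y ** Y y)"
  unfolding matrix_matrix_mult_def
  by (intro continuous_intros assms)

lemma continuous_on_trace:
  fixes X :: "'b::topological_space \<Rightarrow> real^'n::finite^'n"
  assumes "continuous_on S X"
  shows "continuous_on S (\<lambda>y. trace (X y))"
  unfolding trace_def by (intro continuous_intros assms)

text \<open>Cramer's rule writes the entries of the inverse as quotients of determinants.\<close>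

lemma continuous_on_matrix_inv:
  fixes G :: "'b::topological_space \<Rightarrow> real^'n::finite^'n"
  assumes "continuous_on S G" "\<And>y. y \<in> S \<Longrightarrow> invertible (G y)"
  shows "continuous_on S (\<lambda>y. matrix_inv (G y))"
proof -
  \<comment> \<open>The numerator matrix of Cramer's rule for the \<open>l\<close>-th column of the inverse.\<close>
  define B where "B k l y = (\<chi> i j. if j = k then axis l 1 $ i else G y $ i $ j)" for k l y
  have inv: "matrix_inv (G y) $ k $ l = det (B k l y) / det (G y)" if "y \<in> S" for y k l
  proof -
    have "G y *v (matrix_inv (G y) *v axis l 1) = axis l 1"
      using matrix_inv_inverse(1)[OF assms(2)[OF that]] by (simp add: matrix_vector_mul_assoc)
    then have "matrix_inv (G y) *v axis l 1
        = (\<chi> k. det (\<chi> i j. if j = k then axis l 1 $ i else G y $ i $ j) / det (G y))"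
      using cramer[of "G y"] assms(2)[OF that] by (simp add: invertible_det_nz)
    then have "(matrix_inv (G y) *v axis l 1) $ k = det (B k l y) / det (G y)"
      by (simp add: B_def)
    then show ?thesis by (simp add: matrix_vector_mult_basis column_def)
  qed
  have B: "continuous_on S (B k l)" for k l
    unfolding B_def
  proof (intro continuous_on_vec_lambda)
    show "continuous_on S (\<lambda>y. if j = k then axis l 1 $ i else G y $ i $ j)" for i j
      by (cases "j = k") (auto intro!: continuous_intros assms)
  qed
  have "continuous_on S (\<lambda>y. \<chi> k l. det (B k l y) / det (G y))"
    using assms(2) invertible_det_nz
    by (intro continuous_on_vec_lambda continuous_on_divide continuous_on_det B assms(1)) blast
  then show ?thesis
    by (rule continuous_on_cong[THEN iffD1, rotated 2]) (auto simp: vec_eq_iff inv)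
qed

section \<open>Metrics and the trace form\<close>

context compact_mfd
begin

lemma metric_sym: "g \<in> metrics A \<Longrightarrow> g \<in> sym_fields A"
  unfolding metrics_def by blast

lemma metric_pos: "g \<in> metrics A \<Longrightarrow> c \<in> A \<Longrightarrow> x \<in> fst c \<Longrightarrow> v \<noteq> 0 \<Longrightarrow> v \<bullet> (g c x *v v) > 0"
  unfolding metrics_def by blast

lemma metric_invertible: "g \<in> metrics A \<Longrightarrow> c \<in> A \<Longrightarrow> x \<in> fst c \<Longrightarrow> invertible (g c x)"
  by (intro positive_definite_invertible metric_pos)

lemma metric_det_pos: "g \<in> metrics A \<Longrightarrow> c \<in> A \<Longrightarrow> x \<in> fst c \<Longrightarrow> det (g c x) > 0"
  by (intro positive_definite_det_pos metric_pos)

lemma metric_scale: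
  assumes "g \<in> metrics A" "r > 0"
  shows "r *\<^sub>T g \<in> metrics A"
  unfolding metrics_def mem_Collect_eq
proof (intro conjI ballI allI impI)
  show "r *\<^sub>T g \<in> sym_fields A" by (intro sym_fields_scale metric_sym assms)
  fix c x v assume "c \<in> A" "x \<in> fst c" "(v::real^'n) \<noteq> 0"
  with metric_pos[OF assms(1) this] assms(2) show "0 < v \<bullet> ((r *\<^sub>T g) c x *v v)"
    by (simp add: scaleR_matrix_vector_assoc[symmetric])
qed

text \<open>A change of chart with Jacobian \<open>J\<close> replaces \<open>h\<close> by \<open>J\<^sup>T h J\<close> and hence conjugates
  \<open>g\<^sup>-\<^sup>1 h g\<^sup>-\<^sup>1 k\<close> by \<open>J\<close>, which does not change the trace. Since \<^const>\<open>g02\<close> selects some chart at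
  every point separately, this is what makes it a continuous function.\<close>

lemma g02_in_chart:
  assumes "g \<in> metrics A" "h \<in> sym_fields A" "k \<in> sym_fields A" "c \<in> A" "x \<in> fst c"
  shows "g02 A g h k x = trace (matrix_inv (g c x) ** h c x ** matrix_inv (g c x) ** k c x)"
proof -
  define d where "d = chart_at A x"
  have d: "d \<in> A" "x \<in> fst d"
    using chart_at domain_subset_carrier[OF assms(4,5)] by (auto simp: d_def)
  define J where "J = jacobian_at d c x"
  have tr: "u d x = transpose J ** u c x ** J" if "u \<in> sym_fields A" for u
    unfolding J_def by (rule sym_field_transform[OF that d(1) assms(4) d(2) assms(5)])
  have inv: "invertible (g c x)" by (rule metric_invertible) fact+
  have "invertible (g d x)" by (rule metric_invertible[OF assms(1) d])
  then have "det (transpose J ** g c x ** J) \<noteq> 0"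
    by (simp add: tr[OF metric_sym[OF assms(1)], symmetric] invertible_det_nz)
  then have "det J \<noteq> 0" by (auto simp: det_mul)
  then have J: "invertible J" by (simp add: invertible_det_nz)
  then have Jt: "invertible (transpose J)" by (simp add: invertible_det_nz det_transpose)
  define K where "K = matrix_inv J"
  define L where "L = matrix_inv (transpose J)"
  define G where "G = matrix_inv (g c x)"
  have K: "K ** J = mat 1" "J ** K = mat 1" and L: "L ** transpose J = mat 1"
    and G: "G ** g c x = mat 1"
    unfolding K_def L_def G_def by (simp_all add: matrix_inv_inverse J Jt inv)
  have "K ** G ** L ** (transpose J ** g c x ** J) = K ** (G ** ((L ** transpose J) ** g c x) ** J)"
    by (simp only: matrix_mul_assoc)
  then have "matrix_inv (g d x) = K ** G ** L"
    by (intro matrix_inv_unique) (simp add: tr[OF metric_sym[OF assms(1)]] L G K)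
  then have "matrix_inv (g d x) ** h d x ** matrix_inv (g d x) ** k d x
      = K ** (G ** (L ** transpose J) ** h c x ** (J ** K) ** G ** (L ** transpose J) ** k c x ** J)"
    by (simp only: tr[OF assms(2)] tr[OF assms(3)] matrix_mul_assoc)
  then have "trace (matrix_inv (g d x) ** h d x ** matrix_inv (g d x) ** k d x)
      = trace ((G ** h c x ** G ** k c x ** J) ** K)"
    using trace_mul_sym[of K] by (simp add: L K)
  also have "(G ** h c x ** G ** k c x ** J) ** K = G ** h c x ** G ** k c x ** (J ** K)"
    by (simp only: matrix_mul_assoc)
  finally show ?thesis by (simp add: g02_def Let_def d_def K G_def)
qed

lemma g02_linear_left: "g02 A g (r *\<^sub>T h + h') k x = r * g02 A g h k x + g02 A g h' k x"
proof -
  have "(B + C) ** K = B ** K + C ** K" for B C K :: "real^'n^'n"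
    by (simp add: matrix_matrix_mult_def vec_eq_iff sum.distrib distrib_right)
  then show ?thesis
    by (simp add: g02_def Let_def matrix_sandwich_linear matrix_matrix_mult_scaleR trace_add trace_scaleR)
qed

lemma g02_commute: "g02 A g h k x = g02 A g k h x"
proof -
  have "trace (M ** X ** M ** Y) = trace (M ** Y ** M ** X)" for M X Y :: "real^'n^'n"
    using trace_mul_sym[of "M ** X" "M ** Y"] by (simp add: matrix_mul_assoc)
  then show ?thesis by (simp add: g02_def Let_def)
qed

lemma continuous_coord:
  "h \<in> sym_fields A \<Longrightarrow> c \<in> A \<Longrightarrow> continuous_on (image_of c) (\<lambda>y. h c (chart_inv c y))"
proof -
  assume "h \<in> sym_fields A" "c \<in> A"
  then have "iter_deriv [] (coord c h) differentiable_on image_of c"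
    using sym_field_smooth unfolding smooth_on_def by blast
  then have "continuous_on (image_of c) (coord c h)"
    by (simp add: differentiable_imp_continuous_on)
  then show ?thesis
    by (rule continuous_on_cong[THEN iffD1, rotated 2]) (auto simp: coord_def)
qed

lemma continuous_g02:
  assumes "g \<in> metrics A" "h \<in> sym_fields A" "k \<in> sym_fields A" "c \<in> A"
  shows "continuous_on (image_of c) (\<lambda>y. g02 A g h k (chart_inv c y))"
proof -
  have "continuous_on (image_of c) (\<lambda>y. trace (matrix_inv (g c (chart_inv c y)) ** h c (chart_inv c y)
      ** matrix_inv (g c (chart_inv c y)) ** k c (chart_inv c y)))"
    by (intro continuous_on_trace continuous_on_matrix_mult continuous_on_matrix_inv continuous_coord
      assms metric_sym metric_invertible chart_inv_in)
  then show ?thesis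
    by (rule continuous_on_cong[THEN iffD1, rotated 2])
      (use assms chart_inv_in in \<open>auto simp: g02_in_chart\<close>)
qed

end

section \<open>Integration against the volume density\<close>

context compact_mfd
begin

text \<open>A tent function in a chart, extended by zero. The support of the tent is compact, hence closed
  in a Hausdorff space, and so the extension is continuous on the manifold.\<close>

lemma bump_function:
  assumes "x \<in> carrier A"
  obtains c b B where "c \<in> A" "continuous_on (carrier A) b" "\<And>y. 0 \<le> b y" "b x > (0::real)"
    "closed B" "B \<subseteq> fst c" "\<And>y. b y \<noteq> 0 \<Longrightarrow> y \<in> B"
proof -
  from assms obtain c where c: "c \<in> A" "x \<in> fst c" by (auto simp: carrier_def)
  obtain e where e: "e > 0" "cball (snd c x) e \<subseteq> image_of c"
    using open_image_of[OF c(1)] chart_in[OF c] open_contains_cball by blast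
  define b where "b y = (if y \<in> fst c then max 0 (e - dist (snd c y) (snd c x)) else 0)" for y
  define B where "B = chart_inv c ` cball (snd c x) e"
  have cont: "continuous_on (fst c) (snd c)" "continuous_on (image_of c) (chart_inv c)"
    using chart_homeomorphism[OF c(1)] by (auto simp: homeomorphism_def)
  have "compact B" unfolding B_def
    by (intro compact_continuous_image continuous_on_subset[OF cont(2) e(2)] compact_cball)
  then have B: "closed B" by (rule compact_imp_closed)
  have Bc: "B \<subseteq> fst c" using e(2) chart_inv_in[OF c(1)] by (auto simp: B_def)
  have bB: "y \<in> B" if "b y \<noteq> 0" for y
  proof -
    from that have "y \<in> fst c" "snd c y \<in> cball (snd c x) e"
      by (auto simp: b_def max_def dist_commute split: if_splits)
    then show ?thesis unfolding B_def
      by (intro image_eqI[of _ _ "snd c y"]) (simp_all add: chart_inv_cancel[OF c(1)])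
  qed
  have sub: "fst c \<subseteq> carrier A" using c by (auto simp: carrier_def)
  then have car: "carrier A = fst c \<union> (carrier A - B)" using Bc by auto
  have "continuous_on (fst c \<union> (carrier A - B)) b"
  proof (rule continuous_on_Un_local_open)
    show "openin (top_of_set (fst c \<union> (carrier A - B))) (fst c)"
      using car openin_domain[OF c(1)] by simp
    have "openin (top_of_set (carrier A)) (carrier A \<inter> - B)"
      using B by (intro openin_open_Int) auto
    then show "openin (top_of_set (fst c \<union> (carrier A - B))) (carrier A - B)"
      using car by (simp add: Diff_eq)
    have "continuous_on (fst c) (\<lambda>y. max 0 (e - dist (snd c y) (snd c x)))"
      by (intro continuous_intros cont)
    then show "continuous_on (fst c) b"
      by (rule continuous_on_cong[THEN iffD1, rotated 2]) (auto simp: b_def)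
    show "continuous_on (carrier A - B) b"
      by (rule continuous_on_cong[THEN iffD1, OF refl _ continuous_on_const[of _ 0]]) (use bB in force)
  qed
  then show ?thesis using that[of c b B] c e B Bc bB car by (auto simp: b_def)
qed

text \<open>The volume integral is formed with a chosen partition of unity. Existence is needed for the
  choice to mean anything: otherwise the weights could be arbitrary, and the volume negative.\<close>

lemma partition_of_unity_exists: "\<exists>\<rho>. partition_of_unity A \<rho>"
proof -
  define Q where "Q x c b B \<longleftrightarrow> c \<in> A \<and> continuous_on (carrier A) b \<and> (\<forall>y. 0 \<le> b y) \<and> b x > (0::real)
    \<and> closed B \<and> B \<subseteq> fst c \<and> (\<forall>y. b y \<noteq> 0 \<longrightarrow> y \<in> B)" for x b B and c :: "('a, 'n) chart"
  have "\<exists>t. Q x (fst t) (fst (snd t)) (snd (snd t))" if x: "x \<in> carrier A" for x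
  proof -
    obtain c b B where "Q x c b B"
      unfolding Q_def by (rule bump_function[OF x]) blast
    then show ?thesis by (intro exI[of _ "(c, b, B)"]) simp
  qed
  then have "\<exists>T. \<forall>x\<in>carrier A. Q x (fst (T x)) (fst (snd (T x))) (snd (snd (T x)))"
    by (intro bchoice) blast
  then obtain T where T: "\<And>x. x \<in> carrier A \<Longrightarrow> Q x (fst (T x)) (fst (snd (T x))) (snd (snd (T x)))"
    by blast
  define C where "C x = fst (T x)" for x
  define b where "b x = fst (snd (T x))" for x
  define B where "B x = snd (snd (T x))" for x
  have C: "\<And>x. x \<in> carrier A \<Longrightarrow> C x \<in> A"
    and b: "\<And>x. x \<in> carrier A \<Longrightarrow> continuous_on (carrier A) (b x)"
      "\<And>x y. x \<in> carrier A \<Longrightarrow> 0 \<le> b x y" "\<And>x. x \<in> carrier A \<Longrightarrow> b x x > (0::real)"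
    and B: "\<And>x. x \<in> carrier A \<Longrightarrow> closed (B x)" "\<And>x. x \<in> carrier A \<Longrightarrow> B x \<subseteq> fst (C x)"
      "\<And>x y. x \<in> carrier A \<Longrightarrow> b x y \<noteq> 0 \<Longrightarrow> y \<in> B x"
    using T unfolding Q_def C_def b_def B_def by blast+
  define U where "U x = carrier A \<inter> b x -` {0<..}" for x
  have "\<forall>u\<in>U ` carrier A. openin (top_of_set (carrier A)) u"
    unfolding U_def by (auto intro!: continuous_openin_preimage_gen b)
  moreover have "carrier A \<subseteq> \<Union>(U ` carrier A)"
    using b(3) by (auto simp: U_def)
  ultimately obtain D where "D \<subseteq> U ` carrier A" "finite D" "carrier A \<subseteq> \<Union>D"
    using compact_carrier unfolding compact_eq_openin_cover by meson
  then obtain F where F: "F \<subseteq> carrier A" "finite F" "carrier A \<subseteq> \<Union>(U ` F)"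
    by (metis finite_subset_image)
  define s where "s y = (\<Sum>x\<in>F. b x y)" for y
  have s: "s y > 0" if y: "y \<in> carrier A" for y
  proof -
    obtain x where "x \<in> F" "b x y > 0" using F(3) y by (auto simp: U_def)
    then show ?thesis unfolding s_def using F b(2) by (intro sum_pos2[of _ x]) auto
  qed
  define \<rho> where "\<rho> c y = (\<Sum>x | x \<in> F \<and> C x = c. b x y) / s y" for c y
  let ?S = "{c \<in> A. \<exists>x\<in>carrier A. \<rho> c x \<noteq> 0}"
  have sub: "?S \<subseteq> C ` F"
  proof
    fix c assume "c \<in> ?S"
    then obtain y where "(\<Sum>x | x \<in> F \<and> C x = c. b x y) \<noteq> 0" by (auto simp: \<rho>_def)
    then have "{x. x \<in> F \<and> C x = c} \<noteq> {}" by (metis sum.empty)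
    then show "c \<in> C ` F" by auto
  qed
  have "partition_of_unity A \<rho>"
    unfolding partition_of_unity_def
  proof (intro conjI ballI)
    show "finite ?S" using sub F(2) finite_subset by blast
  next
    fix c assume "c \<in> A"
    show "continuous_on (carrier A) (\<rho> c)"
      unfolding \<rho>_def s_def
    proof (intro continuous_on_divide continuous_on_sum b ballI)
      show "(\<Sum>x\<in>F. b x y) \<noteq> 0" if "y \<in> carrier A" for y
        using s[OF that] by (simp add: s_def)
    qed (use F(1) in auto)
  next
    fix c x assume "x \<in> carrier A"
    then show "0 \<le> \<rho> c x" unfolding \<rho>_def using s[of x] F(1) b(2)
      by (intro divide_nonneg_pos sum_nonneg) auto
  next
    fix c assume "c \<in> A"
    have "{x \<in> carrier A. \<rho> c x \<noteq> 0} \<subseteq> (\<Union>x\<in>{x\<in>F. C x = c}. B x)"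
    proof
      fix y assume "y \<in> {x \<in> carrier A. \<rho> c x \<noteq> 0}"
      then have "(\<Sum>x | x \<in> F \<and> C x = c. b x y) \<noteq> 0" by (auto simp: \<rho>_def)
      then obtain x where "x \<in> {x\<in>F. C x = c}" "b x y \<noteq> 0" by (metis (no_types, lifting) sum.neutral)
      then show "y \<in> (\<Union>x\<in>{x\<in>F. C x = c}. B x)" using B(3)[of x y] F(1) by auto
    qed
    moreover have "closed (\<Union>x\<in>{x\<in>F. C x = c}. B x)" using F B(1) by (intro closed_UN) auto
    ultimately have "closure {x \<in> carrier A. \<rho> c x \<noteq> 0} \<subseteq> (\<Union>x\<in>{x\<in>F. C x = c}. B x)"
      by (rule closure_minimal)
    also have "\<dots> \<subseteq> fst c" using F(1) B(2) by auto
    finally show "closure {x \<in> carrier A. \<rho> c x \<noteq> 0} \<subseteq> fst c" .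
  next
    fix y assume y: "y \<in> carrier A"
    have "(\<Sum>c\<in>?S. \<rho> c y) = (\<Sum>c\<in>C ` F. \<rho> c y)"
      using sub F C y by (intro sum.mono_neutral_left) auto
    also have "\<dots> = (\<Sum>c\<in>C ` F. \<Sum>x | x \<in> F \<and> C x = c. b x y) / s y"
      by (simp add: \<rho>_def sum_divide_distrib)
    also have "(\<Sum>c\<in>C ` F. \<Sum>x | x \<in> F \<and> C x = c. b x y) = s y"
      unfolding s_def by (rule sum.image_gen[symmetric]) (rule F(2))
    finally show "(\<Sum>c\<in>?S. \<rho> c y) = 1" using s[OF y] by simp
  qed
  then show ?thesis by blast
qed

definition pou :: "('a, 'n) chart \<Rightarrow> 'a \<Rightarrow> real" where
  "pou = (SOME \<rho>. partition_of_unity A \<rho>)"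

lemma pou: "partition_of_unity A pou"
  unfolding pou_def by (rule someI_ex[OF partition_of_unity_exists])

definition pou_charts :: "('a, 'n) chart set" where
  "pou_charts = {c \<in> A. \<exists>x\<in>carrier A. pou c x \<noteq> 0}"

lemma pou_charts_subset: "c \<in> pou_charts \<Longrightarrow> c \<in> A"
  by (auto simp: pou_charts_def)

lemma vol_integral_eq: "vol_integral A g f = (\<Sum>c\<in>pou_charts. LINT y:image_of c|lborel.
    pou c (chart_inv c y) * f (chart_inv c y) * sqrt (det (coord c g y)))"
  by (simp add: vol_integral_def pou_def pou_charts_def Let_def)

text \<open>The integrand may be unbounded near the boundary of the image of a chart, but the weight is
  supported in a compact subset of it.\<close>

lemma set_integrable_density:
  assumes "g \<in> metrics A" "c \<in> A" "continuous_on (image_of c) (\<lambda>y. f (chart_inv c y))"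
  shows "set_integrable lborel (image_of c)
    (\<lambda>y. pou c (chart_inv c y) * f (chart_inv c y) * sqrt (det (coord c g y)))"
    (is "set_integrable _ _ ?F")
proof -
  let ?Z = "closure {x \<in> carrier A. pou c x \<noteq> 0}"
  have Z: "?Z \<subseteq> fst c" and pc: "continuous_on (carrier A) (pou c)"
    using pou assms(2) by (auto simp: partition_of_unity_def)
  have cont: "continuous_on (fst c) (snd c)" "continuous_on (image_of c) (chart_inv c)"
    using chart_homeomorphism[OF assms(2)] by (auto simp: homeomorphism_def)
  have "?Z \<subseteq> carrier A" by (intro closure_minimal compact_imp_closed compact_carrier) auto
  then have "carrier A \<inter> ?Z = ?Z" by blast
  then have "compact ?Z"
    using compact_Int_closed[OF compact_carrier closed_closure, of "{x \<in> carrier A. pou c x \<noteq> 0}"]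
    by (simp only:)
  define K where "K = snd c ` ?Z"
  have K: "compact K" unfolding K_def
    by (intro compact_continuous_image continuous_on_subset[OF cont(1) Z]) fact
  have Kc: "K \<subseteq> image_of c" using Z by (auto simp: K_def image_of_def)
  have "continuous_on (image_of c) (\<lambda>y. sqrt (det (g c (chart_inv c y))))"
    by (intro continuous_intros continuous_on_det continuous_coord metric_sym assms)
  then have "continuous_on (image_of c) (\<lambda>y. sqrt (det (coord c g y)))"
    by (rule continuous_on_cong[THEN iffD1, rotated 2]) (auto simp: coord_def)
  moreover have "continuous_on (image_of c) (\<lambda>y. pou c (chart_inv c y))"
    by (rule continuous_on_compose2[OF pc cont(2)])
       (use chart_inv_in[OF assms(2)] domain_subset_carrier[OF assms(2)] in auto)
  ultimately have "continuous_on (image_of c) ?F"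
    using assms(3) by (intro continuous_on_mult)
  then have "integrable lborel (\<lambda>y. indicator K y *\<^sub>R ?F y)"
    by (intro borel_integrable_compact K) (rule continuous_on_subset[OF _ Kc])
  moreover have "indicator K y *\<^sub>R ?F y = indicator (image_of c) y *\<^sub>R ?F y" for y
  proof (cases "y \<in> image_of c - K")
    case True
    have y: "chart_inv c y \<in> carrier A" "snd c (chart_inv c y) = y"
      using True chart_inv_in[OF assms(2)] domain_subset_carrier[OF assms(2)]
        chart_homeomorphism[OF assms(2)] by (auto simp: homeomorphism_def)
    have "snd c (chart_inv c y) \<in> K" if "chart_inv c y \<in> ?Z"
      unfolding K_def using that by (rule imageI)
    then have "chart_inv c y \<notin> ?Z" using True y(2) by auto
    then have "chart_inv c y \<notin> {x \<in> carrier A. pou c x \<noteq> 0}"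
      using closure_subset[of "{x \<in> carrier A. pou c x \<noteq> 0}"] by blast
    then have "pou c (chart_inv c y) = 0" using y by blast
    then show ?thesis by simp
  next
    case False
    then show ?thesis using Kc by (auto simp: indicator_def)
  qed
  ultimately show ?thesis by (simp only: set_integrable_def)
qed

lemma vol_integral_linear:
  assumes "g \<in> metrics A" "\<And>c. c \<in> A \<Longrightarrow> continuous_on (image_of c) (\<lambda>y. f (chart_inv c y))"
    "\<And>c. c \<in> A \<Longrightarrow> continuous_on (image_of c) (\<lambda>y. f' (chart_inv c y))"
  shows "vol_integral A g (\<lambda>x. r * f x + f' x) = r * vol_integral A g f + vol_integral A g f'"
proof -
  have "(LINT y:image_of c|lborel. pou c (chart_inv c y) * (r * f (chart_inv c y) + f' (chart_inv c y))
      * sqrt (det (coord c g y)))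
    = r * (LINT y:image_of c|lborel. pou c (chart_inv c y) * f (chart_inv c y) * sqrt (det (coord c g y)))
      + (LINT y:image_of c|lborel. pou c (chart_inv c y) * f' (chart_inv c y) * sqrt (det (coord c g y)))"
    (is "?L c = r * ?R c + ?R' c")
    if "c \<in> A" for c
  proof -
    have "?L c = (LINT y:image_of c|lborel.
       r * (pou c (chart_inv c y) * f (chart_inv c y) * sqrt (det (coord c g y)))
       + pou c (chart_inv c y) * f' (chart_inv c y) * sqrt (det (coord c g y)))"
      by (simp add: algebra_simps)
    also have "\<dots> = (LINT y:image_of c|lborel.
       r * (pou c (chart_inv c y) * f (chart_inv c y) * sqrt (det (coord c g y)))) + ?R' c"
      by (intro set_integral_add set_integrable_mult_right set_integrable_density assms that)
    finally show ?thesis by simp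
  qed
  then show ?thesis
    by (simp add: vol_integral_eq pou_charts_subset sum.distrib sum_distrib_left)
qed

lemma vol_integral_cong:
  assumes "\<And>x. x \<in> carrier A \<Longrightarrow> f x = f' x"
  shows "vol_integral A g f = vol_integral A g f'"
  unfolding vol_integral_eq
proof (intro sum.cong refl set_lebesgue_integral_cong allI impI)
  fix c assume "c \<in> pou_charts"
  then have c: "c \<in> A" by (rule pou_charts_subset)
  show "image_of c \<in> sets lborel" using open_image_of[OF c] by simp
  show "pou c (chart_inv c y) * f (chart_inv c y) * sqrt (det (coord c g y))
      = pou c (chart_inv c y) * f' (chart_inv c y) * sqrt (det (coord c g y))" if "y \<in> image_of c" for y
    using assms[OF domain_subset_carrier[OF c chart_inv_in[OF c that]]] by simp
qed

lemma vol_integral_cmult: "vol_integral A g (\<lambda>x. r * f x) = r * vol_integral A g f"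
proof -
  have "(LINT y:image_of c|lborel. pou c (chart_inv c y) * (r * f (chart_inv c y)) * sqrt (det (coord c g y)))
    = (LINT y:image_of c|lborel. r * (pou c (chart_inv c y) * f (chart_inv c y) * sqrt (det (coord c g y))))" for c
    by (simp add: algebra_simps)
  then show ?thesis by (simp add: vol_integral_eq sum_distrib_left)
qed

lemma vol_integral_scale:
  assumes "r > 0"
  shows "vol_integral A (r *\<^sub>T g) f = r powr (real CARD('n) / 2) * vol_integral A g f"
proof -
  have "sqrt (r ^ CARD('n)) = r powr (real CARD('n) / 2)"
    using assms by (simp add: powr_half_sqrt[symmetric] powr_realpow[symmetric] powr_powr)
  moreover have "coord c (r *\<^sub>T g) y = r *\<^sub>R coord c g y" for c y
    by (simp add: coord_def)
  ultimately have "(LINT y:image_of c|lborel. pou c (chart_inv c y) * f (chart_inv c y) * sqrt (det (coord c (r *\<^sub>T g) y)))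
    = (LINT y:image_of c|lborel. r powr (real CARD('n) / 2) *
        (pou c (chart_inv c y) * f (chart_inv c y) * sqrt (det (coord c g y))))" for c
    by (simp add: det_scaleR real_sqrt_mult algebra_simps)
  then show ?thesis by (simp add: vol_integral_eq sum_distrib_left)
qed

lemma Vol_nonneg:
  assumes "g \<in> metrics A"
  shows "Vol A g \<ge> 0"
  unfolding Vol_def vol_integral_eq
proof (intro sum_nonneg)
  fix c assume "c \<in> pou_charts"
  then have c: "c \<in> A" by (rule pou_charts_subset)
  have p: "0 \<le> pou c x" if "x \<in> carrier A" for x
    using pou c that by (auto simp: partition_of_unity_def)
  have "0 \<le> pou c (chart_inv c y) * 1 * sqrt (det (coord c g y))" if "y \<in> image_of c" for y
    using that p[OF domain_subset_carrier[OF c chart_inv_in[OF c that]]]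
      metric_det_pos[OF assms c chart_inv_in[OF c that]] by (simp add: coord_def)
  then show "0 \<le> (LINT y:image_of c|lborel. pou c (chart_inv c y) * 1 * sqrt (det (coord c g y)))"
    unfolding set_lebesgue_integral_def by (intro integral_nonneg_AE) (auto simp: indicator_def)
qed

lemma tilde_g02_linear_left:
  assumes "g \<in> metrics A" "h \<in> sym_fields A" "h' \<in> sym_fields A" "k \<in> sym_fields A"
  shows "tilde_g02 A g (r *\<^sub>T h + h') k = r * tilde_g02 A g h k + tilde_g02 A g h' k"
proof -
  have "g02 A g (r *\<^sub>T h + h') k = (\<lambda>x. r * g02 A g h k x + g02 A g h' k x)"
    by (intro ext g02_linear_left)
  then show ?thesis unfolding tilde_g02_def
    by (simp add: vol_integral_linear[OF assms(1)] continuous_g02[OF assms(1)] assms)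
qed

lemma tilde_g02_commute: "tilde_g02 A g h k = tilde_g02 A g k h"
proof -
  have "g02 A g h k = g02 A g k h" by (intro ext g02_commute)
  then show ?thesis by (simp add: tilde_g02_def)
qed

lemma tilde_g02_scale_left: "tilde_g02 A g (r *\<^sub>T h) k = r * tilde_g02 A g h k"
proof -
  have "g02 A g (r *\<^sub>T h) k = (\<lambda>x. r * g02 A g h k x)"
    by (intro ext) (simp add: g02_def Let_def matrix_matrix_mult_scaleR trace_scaleR)
  then show ?thesis by (simp add: tilde_g02_def vol_integral_cmult)
qed

lemma tilde_g02_scale_right: "tilde_g02 A g h (r *\<^sub>T k) = r * tilde_g02 A g h k"
  using tilde_g02_scale_left[of g r k h] by (simp add: tilde_g02_commute[of g h])

lemma g02_scale_metric:
  assumes "g \<in> metrics A" "r > 0" "x \<in> carrier A"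
  shows "g02 A (r *\<^sub>T g) h k x = r powr (-2) * g02 A g h k x"
proof -
  have "invertible (g (chart_at A x) x)"
    using chart_at[OF assms(3)] metric_invertible[OF assms(1)] by blast
  then show ?thesis using assms(2)
    by (simp add: g02_def Let_def matrix_inv_scaleR matrix_matrix_mult_scaleR trace_scaleR powr_minus
        power2_eq_square field_simps)
qed

lemma tilde_g02_scale_metric:
  assumes "g \<in> metrics A" "r > 0"
  shows "tilde_g02 A (r *\<^sub>T g) h k = r powr (real CARD('n) / 2 - 2) * tilde_g02 A g h k"
proof -
  have "tilde_g02 A (r *\<^sub>T g) h k = r powr (real CARD('n) / 2) *
      vol_integral A g (\<lambda>x. r powr (-2) * g02 A g h k x)"
    unfolding tilde_g02_def vol_integral_scale[OF assms(2)]
    by (intro arg_cong2[of _ _ _ _ "(*)"] vol_integral_cong g02_scale_metric[OF assms] refl)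
  also have "\<dots> = r powr (real CARD('n) / 2 + (-2)) * tilde_g02 A g h k"
    unfolding vol_integral_cmult tilde_g02_def powr_add by simp
  finally show ?thesis by simp
qed

lemma g02_self:
  assumes "g \<in> metrics A" "x \<in> carrier A"
  shows "g02 A g g g x = real CARD('n)"
proof -
  have "invertible (g (chart_at A x) x)"
    using chart_at[OF assms(2)] metric_invertible[OF assms(1)] by blast
  then show ?thesis by (simp add: g02_def Let_def matrix_inv_inverse trace_I)
qed

lemma tilde_g02_self: "g \<in> metrics A \<Longrightarrow> tilde_g02 A g g g = real CARD('n) * Vol A g"
  unfolding tilde_g02_def Vol_def vol_integral_cmult[symmetric]
  by (intro vol_integral_cong) (simp add: g02_self)

end

section \<open>Smooth functions and arc length in one variable\<close>

text \<open>Differentiability of order \<open>k\<close> by recursion on \<open>k\<close>, so that closure under products and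
  composition is an induction with the elementary differentiation rules, without formulas for higher
  derivatives.\<close>

primrec times_differentiable :: "nat \<Rightarrow> real set \<Rightarrow> (real \<Rightarrow> real) \<Rightarrow> bool" where
  "times_differentiable 0 S f \<longleftrightarrow> True"
| "times_differentiable (Suc k) S f \<longleftrightarrow> (\<exists>f'. (\<forall>x\<in>S. (f has_real_derivative f' x) (at x)) \<and> times_differentiable k S f')"

lemma times_differentiable_SucI:
  "(\<And>x. x \<in> S \<Longrightarrow> (f has_real_derivative f' x) (at x)) \<Longrightarrow> times_differentiable k S f' \<Longrightarrow> times_differentiable (Suc k) S f"
  by (simp only: times_differentiable.simps) blast

lemma times_differentiable_SucE:
  assumes "times_differentiable (Suc k) S f"
  obtains f' where "\<And>x. x \<in> S \<Longrightarrow> (f has_real_derivative f' x) (at x)" "times_differentiable k S f'"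
  using assms by (simp only: times_differentiable.simps) blast

lemma times_differentiable_Suc_D: "times_differentiable (Suc k) S f \<Longrightarrow> times_differentiable k S f"
proof (induction k arbitrary: f)
  case (Suc k)
  then obtain f' where f': "\<And>x. x \<in> S \<Longrightarrow> (f has_real_derivative f' x) (at x)" "times_differentiable (Suc k) S f'"
    by (rule_tac times_differentiable_SucE) blast+
  show ?case by (rule times_differentiable_SucI[OF f'(1) Suc.IH[OF f'(2)]])
qed simp

lemma times_differentiable_const: "times_differentiable k S (\<lambda>x. a)"
  by (induction k arbitrary: a) (simp, rule times_differentiable_SucI[OF DERIV_const])

lemma times_differentiable_add: "times_differentiable k S f \<Longrightarrow> times_differentiable k S g \<Longrightarrow> times_differentiable k S (\<lambda>x. f x + g x)"
proof (induction k arbitrary: f g)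
  case (Suc k)
  obtain f' where f': "\<And>x. x \<in> S \<Longrightarrow> (f has_real_derivative f' x) (at x)" "times_differentiable k S f'"
    by (rule times_differentiable_SucE[OF Suc.prems(1)]) blast
  obtain g' where g': "\<And>x. x \<in> S \<Longrightarrow> (g has_real_derivative g' x) (at x)" "times_differentiable k S g'"
    by (rule times_differentiable_SucE[OF Suc.prems(2)]) blast
  show ?case by (rule times_differentiable_SucI[OF DERIV_add[OF f'(1) g'(1)] Suc.IH[OF f'(2) g'(2)]])
qed simp

lemma times_differentiable_mult: "times_differentiable k S f \<Longrightarrow> times_differentiable k S g \<Longrightarrow> times_differentiable k S (\<lambda>x. f x * g x)"
proof (induction k arbitrary: f g)
  case (Suc k)
  obtain f' where f': "\<And>x. x \<in> S \<Longrightarrow> (f has_real_derivative f' x) (at x)" "times_differentiable k S f'"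
    by (rule times_differentiable_SucE[OF Suc.prems(1)]) blast
  obtain g' where g': "\<And>x. x \<in> S \<Longrightarrow> (g has_real_derivative g' x) (at x)" "times_differentiable k S g'"
    by (rule times_differentiable_SucE[OF Suc.prems(2)]) blast
  have "times_differentiable k S (\<lambda>x. f x * g' x + f' x * g x)"
    by (intro times_differentiable_add Suc.IH f'(2) g'(2) times_differentiable_Suc_D[OF Suc.prems(1)] times_differentiable_Suc_D[OF Suc.prems(2)])
  with DERIV_mult'[OF f'(1) g'(1)] show ?case by (rule times_differentiable_SucI)
qed simp

lemma times_differentiable_compose:
  "times_differentiable k T f \<Longrightarrow> times_differentiable k S g \<Longrightarrow> g ` S \<subseteq> T \<Longrightarrow> times_differentiable k S (\<lambda>x. f (g x))"
proof (induction k arbitrary: f g)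
  case (Suc k)
  obtain f' where f': "\<And>x. x \<in> T \<Longrightarrow> (f has_real_derivative f' x) (at x)" "times_differentiable k T f'"
    by (rule times_differentiable_SucE[OF Suc.prems(1)]) blast
  obtain g' where g': "\<And>x. x \<in> S \<Longrightarrow> (g has_real_derivative g' x) (at x)" "times_differentiable k S g'"
    by (rule times_differentiable_SucE[OF Suc.prems(2)]) blast
  have "times_differentiable k S (\<lambda>x. f' (g x) * g' x)"
    by (rule times_differentiable_mult[OF Suc.IH[OF f'(2) times_differentiable_Suc_D[OF Suc.prems(2)] Suc.prems(3)] g'(2)])
  moreover have "((\<lambda>x. f (g x)) has_real_derivative f' (g x) * g' x) (at x)" if "x \<in> S" for x
    using Suc.prems(3) that by (intro DERIV_chain2 f' g') auto
  ultimately show ?case by (intro times_differentiable_SucI)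
qed simp

lemma times_differentiable_powr: "times_differentiable k {0<..} (\<lambda>x. x powr a)"
proof (induction k arbitrary: a)
  case (Suc k)
  have "times_differentiable k {0<..} (\<lambda>x. a * x powr (a - 1))"
    by (intro times_differentiable_mult times_differentiable_const Suc.IH)
  then show ?case
    by (rule times_differentiable_SucI[rotated]) (auto intro!: has_real_derivative_powr)
qed simp

lemma times_differentiable_ln: "times_differentiable k {0<..} ln"
proof (cases k)
  case (Suc j)
  have "(ln has_real_derivative x powr (-1)) (at x)" if "x \<in> {0<..}" for x :: real
    using DERIV_ln[of x] that by (simp add: powr_minus)
  then show ?thesis unfolding Suc by (rule times_differentiable_SucI[OF _ times_differentiable_powr])
qed simp

text \<open>Bootstrapping: if \<open>f\<close> has \<open>k\<close> derivatives, then so has \<open>u \<circ> f\<close>, which is the derivative of \<open>f\<close>.\<close>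

lemma times_differentiable_autonomous_ode:
  assumes "\<And>k. times_differentiable k T u" "f ` S \<subseteq> T" "\<And>x. x \<in> S \<Longrightarrow> (f has_real_derivative u (f x)) (at x)"
  shows "times_differentiable k S f"
proof (induction k)
  case (Suc k)
  show ?case by (rule times_differentiable_SucI[OF assms(3) times_differentiable_compose[OF assms(1) Suc assms(2)]])
qed simp

lemma times_differentiable_cong:
  assumes "open S" "\<And>x. x \<in> S \<Longrightarrow> f x = g x" "times_differentiable k S f"
  shows "times_differentiable k S g"
proof (cases k)
  case (Suc j)
  obtain f' where f': "\<And>x. x \<in> S \<Longrightarrow> (f has_real_derivative f' x) (at x)" "times_differentiable j S f'"
    by (rule times_differentiable_SucE[OF assms(3)[unfolded Suc]]) blast
  show ?thesis unfolding Suc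
  proof (rule times_differentiable_SucI[OF _ f'(2)])
    show "(g has_real_derivative f' x) (at x)" if "x \<in> S" for x
      by (rule has_field_derivative_transform_within_open[OF f'(1)[OF that] assms(1) that assms(2)])
  qed
qed simp

lemma times_differentiable_deriv:
  assumes "open S" "times_differentiable (Suc k) S f"
  shows "times_differentiable k S (deriv f)" "x \<in> S \<Longrightarrow> (f has_real_derivative deriv f x) (at x)"
proof -
  obtain f' where f': "\<And>x. x \<in> S \<Longrightarrow> (f has_real_derivative f' x) (at x)" "times_differentiable k S f'"
    by (rule times_differentiable_SucE[OF assms(2)]) blast
  have eq: "f' x = deriv f x" if "x \<in> S" for x
    using DERIV_imp_deriv[OF f'(1)[OF that]] by simp
  show "times_differentiable k S (deriv f)" by (rule times_differentiable_cong[OF assms(1) eq f'(2)])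
  show "x \<in> S \<Longrightarrow> (f has_real_derivative deriv f x) (at x)" using f'(1)[of x] eq by simp
qed

lemma higher_deriv_real:
  assumes "open S" "\<And>k. times_differentiable k S f" "x \<in> S"
  shows "((deriv ^^ k) f has_real_derivative (deriv ^^ Suc k) f x) (at x)"
proof -
  have "times_differentiable j S ((deriv ^^ k) f)" for j
  proof (induction k arbitrary: j)
    case (Suc k)
    show ?case using times_differentiable_deriv(1)[OF assms(1) Suc.IH] by simp
  qed (simp add: assms)
  from times_differentiable_deriv(2)[OF assms(1) this assms(3)] show ?thesis by simp
qed

lemma times_differentiable_of_sequence:
  assumes "\<And>k x. x \<in> S \<Longrightarrow> (D k has_real_derivative D (Suc k) x) (at x)"
  shows "times_differentiable k S (D j)"
proof (induction k arbitrary: j)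
  case (Suc k)
  show ?case by (rule times_differentiable_SucI[OF assms Suc.IH])
qed simp

lemma antiderivative_on_halfline:
  fixes w :: "real \<Rightarrow> real"
  assumes "\<And>r. r > 0 \<Longrightarrow> isCont w r"
  obtains W where "\<And>r. r > 0 \<Longrightarrow> (W has_real_derivative w r) (at r)"
proof -
  have "\<exists>W. \<forall>x::real. (0::ereal) < ereal x \<longrightarrow> ereal x < \<infinity> \<longrightarrow> (W has_vector_derivative w x) (at x)"
    by (rule einterval_antiderivative) (use assms in auto)
  then show ?thesis using that
    by (auto simp: has_real_derivative_iff_has_vector_derivative)
qed



lemma nn_integral_abs_derivative:
  fixes F f :: "real \<Rightarrow> real"
  assumes F: "\<And>t. t \<in> {0..1} \<Longrightarrow> (F has_real_derivative f t) (at t within {0..1})"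
    and f: "continuous_on {0..1} f"
  shows "ennreal \<bar>F 1 - F 0\<bar> \<le> (\<integral>\<^sup>+t\<in>{0..1}. ennreal \<bar>f t\<bar> \<partial>lborel)"
    and "(\<forall>t\<in>{0..1}. 0 \<le> f t) \<or> (\<forall>t\<in>{0..1}. f t \<le> 0) \<Longrightarrow>
      (\<integral>\<^sup>+t\<in>{0..1}. ennreal \<bar>f t\<bar> \<partial>lborel) = ennreal \<bar>F 1 - F 0\<bar>"
proof -
  have FTC: "(\<integral>t. indicator {0..1} t *\<^sub>R f t \<partial>lborel) = F 1 - F 0"
    using F by (intro integral_FTC_atLeastAtMost f)
      (auto simp: has_real_derivative_iff_has_vector_derivative)
  have "set_integrable lborel {0..1} (\<lambda>t. \<bar>f t\<bar>)"
    by (intro borel_integrable_atLeastAtMost' continuous_intros f)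
  then have int: "integrable lborel (\<lambda>t. indicator {0..1} t *\<^sub>R \<bar>f t\<bar>)"
    by (simp add: set_integrable_def)
  have "(\<integral>\<^sup>+t\<in>{0..1}. ennreal \<bar>f t\<bar> \<partial>lborel) = (\<integral>\<^sup>+t. ennreal (indicator {0..1} t *\<^sub>R \<bar>f t\<bar>) \<partial>lborel)"
    by (intro nn_integral_cong) (auto simp: indicator_def)
  also have "\<dots> = ennreal (\<integral>t. indicator {0..1} t *\<^sub>R \<bar>f t\<bar> \<partial>lborel)"
    by (rule nn_integral_eq_integral[OF int]) auto
  finally have eq: "(\<integral>\<^sup>+t\<in>{0..1}. ennreal \<bar>f t\<bar> \<partial>lborel)
      = ennreal (\<integral>t. indicator {0..1} t *\<^sub>R \<bar>f t\<bar> \<partial>lborel)" .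
  have "\<bar>\<integral>t. indicator {0..1} t *\<^sub>R f t \<partial>lborel\<bar> \<le> (\<integral>t. \<bar>indicator {0..1} t *\<^sub>R f t\<bar> \<partial>lborel)"
    using integral_norm_bound[of lborel "\<lambda>t. indicator {0..1} t *\<^sub>R f t"] by simp
  also have "\<dots> = (\<integral>t. indicator {0..1} t *\<^sub>R \<bar>f t\<bar> \<partial>lborel)"
    by (simp add: abs_mult)
  finally show "ennreal \<bar>F 1 - F 0\<bar> \<le> (\<integral>\<^sup>+t\<in>{0..1}. ennreal \<bar>f t\<bar> \<partial>lborel)"
    unfolding eq FTC by (rule ennreal_leI)
  have nonneg: "0 \<le> (\<integral>t. indicator {0..1} t *\<^sub>R \<bar>f t\<bar> \<partial>lborel)"
    by (intro integral_nonneg_AE) auto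
  assume "(\<forall>t\<in>{0..1}. 0 \<le> f t) \<or> (\<forall>t\<in>{0..1}. f t \<le> 0)"
  then have "(\<integral>t. indicator {0..1} t *\<^sub>R \<bar>f t\<bar> \<partial>lborel) = \<bar>F 1 - F 0\<bar>"
  proof
    assume "\<forall>t\<in>{0..1}. 0 \<le> f t"
    then have "(\<lambda>t. indicator {0..1} t *\<^sub>R \<bar>f t\<bar>) = (\<lambda>t. indicator {0..1} t *\<^sub>R f t)"
      by (auto simp: fun_eq_iff indicator_def)
    then show ?thesis using FTC nonneg by simp
  next
    assume "\<forall>t\<in>{0..1}. f t \<le> 0"
    then have "(\<lambda>t. indicator {0..1} t *\<^sub>R \<bar>f t\<bar>) = (\<lambda>t. - (indicator {0..1} t *\<^sub>R f t))"
      by (auto simp: fun_eq_iff indicator_def)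
    then show ?thesis using FTC nonneg by simp
  qed
  then show "(\<integral>\<^sup>+t\<in>{0..1}. ennreal \<bar>f t\<bar> \<partial>lborel) = ennreal \<bar>F 1 - F 0\<bar>"
    unfolding eq by simp
qed

text \<open>Near \<open>0\<close> the function \<open>W r - C r\<^bsup>\<beta>+1\<^esup> / (\<beta>+1)\<close> is decreasing, because its derivative is at most
  \<open>0\<close>. As \<open>\<beta> + 1 > 0\<close>, this bounds the increasing function \<open>W\<close> from below.\<close>

lemma integrable_power_antiderivative_converges:
  fixes W w :: "real \<Rightarrow> real"
  assumes W: "\<And>r. r > 0 \<Longrightarrow> (W has_real_derivative w r) (at r)"
    and pos: "\<And>r. r > 0 \<Longrightarrow> w r > 0"
    and \<delta>: "\<delta> > 0" "\<And>r. 0 < r \<Longrightarrow> r \<le> \<delta> \<Longrightarrow> w r \<le> C * r powr \<beta>" and \<beta>: "\<beta> > -1"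
  shows "convergent (\<lambda>k. W (1 / real (Suc k)))"
proof -
  have mono: "W r \<le> W s" if "0 < r" "r \<le> s" for r s
  proof (rule DERIV_nonneg_imp_nondecreasing[OF that(2)])
    fix x assume "r \<le> x" "x \<le> s"
    then show "\<exists>y. (W has_real_derivative y) (at x) \<and> 0 \<le> y"
      using W[of x] pos[of x] that by (intro exI[of _ "w x"]) auto
  qed
  define V where "V r = W r - C / (\<beta> + 1) * r powr (\<beta> + 1)" for r
  have V: "V \<delta> \<le> V r" if "0 < r" "r \<le> \<delta>" for r
  proof (rule DERIV_nonpos_imp_nonincreasing[OF that(2)])
    fix s assume s: "r \<le> s" "s \<le> \<delta>"
    have "(V has_real_derivative w s - C / (\<beta> + 1) * ((\<beta> + 1) * s powr (\<beta> + 1 - 1))) (at s)"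
      unfolding V_def using W s that
      by (intro DERIV_diff DERIV_cmult has_real_derivative_powr) auto
    moreover have "w s - C / (\<beta> + 1) * ((\<beta> + 1) * s powr (\<beta> + 1 - 1)) \<le> 0"
      using \<delta>(2)[of s] s that \<beta> by simp
    ultimately show "\<exists>y. (V has_real_derivative y) (at s) \<and> y \<le> 0" by blast
  qed
  have "0 < w \<delta>" "w \<delta> \<le> C * \<delta> powr \<beta>" using pos \<delta> by auto
  then have "0 < C * \<delta> powr \<beta>" by simp
  then have "C > 0" using \<delta>(1) by (simp add: zero_less_mult_iff)
  have low: "V \<delta> \<le> W r" if "0 < r" for r
  proof (cases "r \<le> \<delta>")
    case True
    have "V r \<le> W r" using \<open>C > 0\<close> \<beta> by (simp add: V_def)
    then show ?thesis using V[OF that True] by simp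
  next
    case False
    have "V \<delta> \<le> W \<delta>" using \<open>C > 0\<close> \<beta> by (simp add: V_def)
    also have "\<dots> \<le> W r" using False \<delta>(1) by (intro mono) auto
    finally show ?thesis .
  qed
  have "decseq (\<lambda>k. W (1 / real (Suc k)))"
    unfolding decseq_def by (auto intro!: mono divide_left_mono)
  moreover have "\<forall>k. V \<delta> \<le> W (1 / real (Suc k))" by (auto intro!: low)
  ultimately show ?thesis
    using decseq_convergent convergentI by blast
qed

section \<open>The induced metric on the ray\<close>

context compact_mfd
begin

lemma metric_nonzero_entry:
  assumes "g \<in> metrics A"
  obtains e x i j where "e \<in> A" "x \<in> fst e" "g e x $ i $ j \<noteq> 0"
proof -
  obtain e x where e: "e \<in> A" "x \<in> fst e" using carrier_nonempty by (auto simp: carrier_def)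
  have "g e x \<noteq> 0"
  proof
    assume "g e x = 0"
    then show False using metric_pos[OF assms e, of "axis undefined 1"] by (simp add: axis_eq_0_iff)
  qed
  then obtain i j where "g e x $ i $ j \<noteq> 0" by (auto simp: vec_eq_iff)
  with e show ?thesis by (rule that)
qed

lemma metric_scale_inject: "g \<in> metrics A \<Longrightarrow> a *\<^sub>T g = b *\<^sub>T g \<Longrightarrow> a = b"
proof -
  assume g: "g \<in> metrics A" and eq: "a *\<^sub>T g = b *\<^sub>T g"
  obtain e x i j where "e \<in> A" "x \<in> fst e" and nz: "g e x $ i $ j \<noteq> 0"
    by (rule metric_nonzero_entry[OF g]) (rule that)
  have "(a *\<^sub>T g) e x $ i $ j = (b *\<^sub>T g) e x $ i $ j" by (simp only: eq)
  with nz show "a = b" by simp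
qed

lemma linear_on_fields_scale:
  assumes "linear_on_fields A T" "h \<in> sym_fields A"
  shows "T (r *\<^sub>T h) = r *\<^sub>T T h"
proof -
  have lin: "T (r *\<^sub>T h + k) = r *\<^sub>T T h + T k" if "h \<in> sym_fields A" "k \<in> sym_fields A" for r h k
    using assms(1) that unfolding linear_on_fields_def by blast
  have "T 0 = T 0 + T 0"
    using lin[OF zero_in_sym_fields zero_in_sym_fields, of 1] by (simp add: tscale_algebra)
  then have "T 0 = 0" by (simp only: add_cancel_right_right)
  with lin[OF assms(2) zero_in_sym_fields, of r] show ?thesis by simp
qed

text \<open>The family \<open>F\<close> lists the successive derivatives of the coefficient.\<close>

lemma smooth_curve_scalar:
  assumes "u \<in> sym_fields A"
    "\<And>k t. t \<in> S \<Longrightarrow> (F k has_real_derivative F (Suc k) t) (at t within S)"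
  shows "smooth_curve A S (\<lambda>t. F 0 t *\<^sub>T u)"
  unfolding smooth_curve_def
proof (intro conjI exI[of _ "\<lambda>k t. F k t *\<^sub>T u"] ballI allI refl)
  show "F 0 t *\<^sub>T u \<in> sym_fields A" for t by (rule sym_fields_scale) fact
  show "has_curve_deriv A S (\<lambda>t. F k t *\<^sub>T u) (F (Suc k) t *\<^sub>T u) t" if "t \<in> S" for k t
    by (rule has_curve_deriv_scalar[OF assms(1) assms(2)[OF that]]) simp_all
qed

lemma has_curve_deriv_scalar_on:
  assumes "u \<in> sym_fields A" "(\<phi> has_real_derivative D) (at t within S)" "t \<in> S"
    "\<And>s. s \<in> S \<Longrightarrow> c s = \<phi> s *\<^sub>T u"
  shows "has_curve_deriv A S c (D *\<^sub>T u) t"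
proof (rule has_curve_deriv_scalar[OF assms(1,2)])
  show "\<forall>\<^sub>F s in at t within S. c s = \<phi> s *\<^sub>T u"
    using assms(4) by (auto simp: eventually_at_filter)
  show "c t = \<phi> t *\<^sub>T u" using assms(3,4) by simp
qed

end

locale conformal_ray = compact_mfd A
  for A :: "('a::t2_space, 'n::finite) chart set" +
  fixes p :: real
    and P :: "('a, 'n) field \<Rightarrow> ('a, 'n) field \<Rightarrow> ('a, 'n) field"
    and g0 :: "('a, 'n) field"
    and \<Psi> :: "real \<Rightarrow> real"
  assumes admissible: "admissible_operator A p P"
    and g0_metric: "g0 \<in> metrics A"
    and P_ray_g0: "r > 0 \<Longrightarrow> P (r *\<^sub>T g0) g0 = \<Psi> r *\<^sub>T g0"
begin

lemma g0_sym: "g0 \<in> sym_fields A"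
  by (rule metric_sym[OF g0_metric])

lemma ray_metric: "r > 0 \<Longrightarrow> r *\<^sub>T g0 \<in> metrics A"
  by (rule metric_scale[OF g0_metric])

lemma g0_inject: "a *\<^sub>T g0 = b *\<^sub>T g0 \<longleftrightarrow> a = b"
  using metric_scale_inject[OF g0_metric] by auto

lemma
  assumes "g \<in> metrics A"
  shows P_linear: "linear_on_fields A (P g)"
    and P_bij: "bij_betw (P g) (sym_fields A) (sym_fields A)"
    and P_positive: "h \<in> sym_fields A \<Longrightarrow> h \<noteq> 0 \<Longrightarrow> tilde_g02 A g (P g h) h > 0"
  using admissible assms unfolding admissible_operator_def pseudo_differential_def by blast+

lemma P_ray: "r > 0 \<Longrightarrow> P (r *\<^sub>T g0) (s *\<^sub>T g0) = (s * \<Psi> r) *\<^sub>T g0"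
  by (simp add: linear_on_fields_scale[OF P_linear[OF ray_metric] g0_sym] P_ray_g0 tscale_algebra)

text \<open>Replacing \<open>g0\<close> by \<open>r g0\<close> multiplies \<^const>\<open>g02\<close> by \<open>r\<^sup>-\<^sup>2\<close> and the volume density by \<open>r\<^bsup>n/2\<^esup>\<close>, and
  the trace of \<open>g0\<^sup>-\<^sup>1 g0\<close> is \<open>n\<close>.\<close>

lemma GP_ray:
  assumes "r > 0"
  shows "GP A P (r *\<^sub>T g0) (a *\<^sub>T g0) (b *\<^sub>T g0)
    = a * b * (real CARD('n) * Vol A g0 * (\<Psi> r * r powr (real CARD('n) / 2 - 2)))"
  unfolding GP_def P_ray[OF assms] tilde_g02_scale_left tilde_g02_scale_right
    tilde_g02_scale_metric[OF g0_metric assms] tilde_g02_self[OF g0_metric] by simp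

text \<open>Positivity of \<open>P\<close> makes the product of \<open>Vol(g0)\<close> and \<open>\<Psi> r\<close> positive. The volume is nonnegative,
  and this decides the signs of both factors.\<close>

lemma
  shows Vol_pos: "Vol A g0 > 0" and \<Psi>_pos: "r > 0 \<Longrightarrow> \<Psi> r > 0"
proof -
  have "g0 \<noteq> 0" using g0_inject[of 1 0] by (auto simp: tscale_algebra)
  then have *: "real CARD('n) * Vol A g0 * (\<Psi> r * r powr (real CARD('n) / 2 - 2)) > 0" if "r > 0" for r
    using P_positive[OF ray_metric[OF that] g0_sym] GP_ray[OF that, of 1 1]
    by (simp add: GP_def tscale_algebra)
  have "Vol A g0 \<noteq> 0" using *[of 1] by auto
  then show V: "Vol A g0 > 0" using Vol_nonneg[OF g0_metric] by simp
  assume "r > 0"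
  have "0 < real CARD('n) * Vol A g0" using V by simp
  from zero_less_mult_pos[OF *[OF \<open>r > 0\<close>] this] \<open>r > 0\<close> show "\<Psi> r > 0"
    by (simp add: zero_less_mult_iff)
qed

text \<open>Smoothness of \<open>P\<close> is tested on curves of metrics that are defined on all of \<open>\<real>\<close>. The curve
  \<open>e\<^sup>t g0\<close> is one that covers the whole ray. It shows that \<open>\<Psi> \<circ> exp\<close> is smooth.\<close>

lemma \<Psi>_smooth: "times_differentiable k {0<..} \<Psi>"
proof -
  obtain e x i j where e: "e \<in> A" "x \<in> fst e" and nz: "g0 e x $ i $ j \<noteq> 0"
    by (rule metric_nonzero_entry[OF g0_metric]) (rule that)
  have "smooth_curve A UNIV (\<lambda>t. exp t *\<^sub>T g0)"
    by (rule smooth_curve_scalar[OF g0_sym, of UNIV "\<lambda>k t. exp t"]) (rule DERIV_exp)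
  moreover have "range (\<lambda>t. exp t *\<^sub>T g0) \<subseteq> metrics A" by (auto intro: ray_metric)
  moreover have "smooth_curve A UNIV (\<lambda>t. (if (0::nat) = 0 then 1 else 0) *\<^sub>T g0)"
    by (rule smooth_curve_scalar[OF g0_sym, of UNIV "\<lambda>k t. if k = 0 then 1 else 0"]) auto
  ultimately have "smooth_curve A UNIV (\<lambda>t. P (exp t *\<^sub>T g0) g0)"
    using admissible unfolding admissible_operator_def smooth_operator_field_def
    by (simp add: tscale_algebra)
  then obtain d where d0: "\<And>t. d 0 t = P (exp t *\<^sub>T g0) g0"
    and d: "\<And>k t. has_curve_deriv A UNIV (d k) (d (Suc k) t) t"
    unfolding smooth_curve_def by auto
  define D where "D k t = d k t e x $ i $ j / g0 e x $ i $ j" for k t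
  have "(D k has_real_derivative D (Suc k) t) (at t)" for k t
    unfolding D_def by (rule DERIV_cdivide[OF has_curve_deriv_entry[OF d e]])
  then have D: "times_differentiable k UNIV (D 0)" by (rule times_differentiable_of_sequence)
  have D0: "D 0 t = \<Psi> (exp t)" for t
    using nz by (simp add: D_def d0 P_ray_g0)
  have "times_differentiable k {0<..} (\<lambda>r. D 0 (ln r))"
    by (rule times_differentiable_compose[OF D times_differentiable_ln]) simp
  then show ?thesis
    by (rule times_differentiable_cong[rotated 2]) (auto simp: D0)
qed

text \<open>The \<open>G\<^sup>P\<close>-norm of \<open>g0\<close> at the metric \<open>r g0\<close>, i.e. the density of arc length in the coordinate \<open>r\<close>.\<close>

definition speed :: "real \<Rightarrow> real" where
  "speed r = sqrt (real CARD('n) * Vol A g0 * (\<Psi> r * r powr (real CARD('n) / 2 - 2)))"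

lemma speed_pos: "r > 0 \<Longrightarrow> speed r > 0"
  unfolding speed_def using Vol_pos \<Psi>_pos by simp

lemma \<Psi>_differentiable: "r > 0 \<Longrightarrow> (\<Psi> has_real_derivative deriv \<Psi> r) (at r)"
  using times_differentiable_deriv(2)[OF open_greaterThan \<Psi>_smooth] by blast

lemma speed_continuous: "r > 0 \<Longrightarrow> isCont speed r"
  unfolding speed_def
  using DERIV_isCont[OF \<Psi>_differentiable, of r] by (intro continuous_intros) auto

lemma smooth_ray_curve:
  assumes "smooth_curve A S c" "c ` S \<subseteq> ray g0" and nt: "\<And>t. t \<in> S \<Longrightarrow> at t within S \<noteq> bot"
  obtains f f' where "\<And>t. t \<in> S \<Longrightarrow> f t > 0" "\<And>t. t \<in> S \<Longrightarrow> c t = f t *\<^sub>T g0"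
    "\<And>t. t \<in> S \<Longrightarrow> (f has_real_derivative f' t) (at t within S)" "continuous_on S f'"
proof -
  obtain e x i j where e: "e \<in> A" "x \<in> fst e" and nz: "g0 e x $ i $ j \<noteq> 0"
    by (rule metric_nonzero_entry[OF g0_metric]) (rule that)
  obtain d where d0: "\<And>t. t \<in> S \<Longrightarrow> d 0 t = c t"
    and d: "\<And>k t. t \<in> S \<Longrightarrow> has_curve_deriv A S (d k) (d (Suc k) t) t"
    using assms(1) unfolding smooth_curve_def by blast
  define D where "D k t = d k t e x $ i $ j / g0 e x $ i $ j" for k t
  have D: "(D k has_real_derivative D (Suc k) t) (at t within S)" if "t \<in> S" for k t
    unfolding D_def by (rule DERIV_cdivide[OF has_curve_deriv_entry[OF d[OF that] e]])
  have c: "D 0 t > 0 \<and> c t = D 0 t *\<^sub>T g0" if t: "t \<in> S" for t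
  proof -
    obtain r where "r > 0" "c t = r *\<^sub>T g0" using assms(2) t by (auto simp: ray_def)
    moreover from this have "D 0 t = r" using nz by (simp add: D_def d0[OF t])
    ultimately show ?thesis by simp
  qed
  show ?thesis
  proof (rule that)
    show "continuous_on S (D (Suc 0))" using D[of _ "Suc 0"] by (rule DERIV_continuous_on)
  qed (use c D in auto)
qed

lemma ray_curve_length:
  assumes f: "\<And>t. t \<in> {0..1} \<Longrightarrow> f t > 0" "\<And>t. t \<in> {0..1} \<Longrightarrow> c t = f t *\<^sub>T g0"
    and f': "\<And>t. t \<in> {0..1} \<Longrightarrow> (f has_real_derivative f' t) (at t within {0..1})"
  shows "curve_length A (GP A P) 0 1 c = (\<integral>\<^sup>+t\<in>{0..1}. ennreal \<bar>speed (f t) * f' t\<bar> \<partial>lborel)"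
  unfolding curve_length_def
proof (intro nn_integral_cong)
  fix t :: real
  show "ennreal (sqrt (GP A P (c t) (curve_deriv A {0..1} c t) (curve_deriv A {0..1} c t))) * indicator {0..1} t
      = ennreal \<bar>speed (f t) * f' t\<bar> * indicator {0..1} t"
  proof (cases "t \<in> {0..1}")
    case True
    have "has_curve_deriv A {0..1} c (f' t *\<^sub>T g0) t"
      by (rule has_curve_deriv_scalar_on[OF g0_sym f'[OF True] True f(2)])
    then have "curve_deriv A {0..1} c t = f' t *\<^sub>T g0"
      by (rule curve_deriv_eq) (use True in \<open>simp add: trivial_limit_within islimpt_Icc\<close>)
    then have "sqrt (GP A P (c t) (curve_deriv A {0..1} c t) (curve_deriv A {0..1} c t))
        = sqrt (f' t * f' t) * speed (f t)"
      by (simp only: f(2)[OF True] GP_ray[OF f(1)[OF True]] real_sqrt_mult speed_def)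
    also have "\<dots> = \<bar>speed (f t) * f' t\<bar>"
      using speed_pos[OF f(1)[OF True]] by (simp add: abs_mult)
    finally show ?thesis by simp
  qed simp
qed

text \<open>Because \<open>W' = speed\<close>, the length of a path in the ray is the total variation of \<open>W\<close> along it.
  This is at least the difference of the end values, with equality for the straight path, along which
  \<open>W\<close> is monotone.\<close>

lemma path_dist_ray:
  assumes W: "\<And>r. r > 0 \<Longrightarrow> (W has_real_derivative speed r) (at r)" and "a > 0" "b > 0"
  shows "path_dist A (GP A P) (ray g0) (a *\<^sub>T g0) (b *\<^sub>T g0) = \<bar>W b - W a\<bar>"
proof -
  let ?S = "{c. smooth_curve A {0..1} c \<and> c ` {0..1} \<subseteq> ray g0 \<and> c 0 = a *\<^sub>T g0 \<and> c 1 = b *\<^sub>T g0}"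
  have Wf: "((\<lambda>t. W (f t)) has_real_derivative speed (f t) * D) (at t within {0..1})"
    if "(f has_real_derivative D) (at t within {0..1})" "f t > 0" for f D t
    by (rule DERIV_chain'[OF that(1) W[OF that(2)]])
  have cont: "continuous_on {0..1} (\<lambda>t. speed (f t) * f' t)"
    if "\<And>t. t \<in> {0..1} \<Longrightarrow> f t > 0" "continuous_on {0..1} f" "continuous_on {0..1} f'" for f f' :: "real \<Rightarrow> real"
  proof -
    have "continuous_on {0<..} speed"
      by (intro continuous_at_imp_continuous_on ballI speed_continuous) simp
    then have "continuous_on {0..1} (\<lambda>t. speed (f t))"
      by (rule continuous_on_compose2[OF _ that(2)]) (use that(1) in auto)
    then show ?thesis by (rule continuous_on_mult[OF _ that(3)])
  qed
  have lower: "ennreal \<bar>W b - W a\<bar> \<le> curve_length A (GP A P) 0 1 c" if c: "c \<in> ?S" for c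
  proof -
    have nt: "at t within {0..1} \<noteq> bot" if "t \<in> {0..1}" for t :: real
      using that by (simp add: trivial_limit_within islimpt_Icc)
    obtain f f' where f: "\<And>t. t \<in> {0..1} \<Longrightarrow> f t > 0" "\<And>t. t \<in> {0..1} \<Longrightarrow> c t = f t *\<^sub>T g0"
      and f': "\<And>t. t \<in> {0..1} \<Longrightarrow> (f has_real_derivative f' t) (at t within {0..1})" "continuous_on {0..1} f'"
      using smooth_ray_curve[of "{0..1}" c] c nt by blast
    have "f 0 = a" "f 1 = b" using f(2)[of 0] f(2)[of 1] c by (auto simp: g0_inject)
    moreover have "ennreal \<bar>W (f 1) - W (f 0)\<bar>
        \<le> (\<integral>\<^sup>+t\<in>{0..1}. ennreal \<bar>speed (f t) * f' t\<bar> \<partial>lborel)"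
    proof (rule nn_integral_abs_derivative(1))
      show "((\<lambda>t. W (f t)) has_real_derivative speed (f t) * f' t) (at t within {0..1})"
        if "t \<in> {0..1}" for t by (rule Wf[OF f'(1)[OF that] f(1)[OF that]])
      show "continuous_on {0..1} (\<lambda>t. speed (f t) * f' t)"
        by (rule cont[OF f(1) DERIV_continuous_on[OF f'(1)] f'(2)])
    qed
    moreover have "curve_length A (GP A P) 0 1 c
        = (\<integral>\<^sup>+t\<in>{0..1}. ennreal \<bar>speed (f t) * f' t\<bar> \<partial>lborel)"
      by (rule ray_curve_length) (use f f'(1) in auto)
    ultimately show ?thesis by simp
  qed
  define f where "f t = a + t * (b - a)" for t
  have f: "f t > 0" if "t \<in> {0..1}" for t
  proof -
    have "f t = (1 - t) * a + t * b" by (simp add: f_def algebra_simps)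
    moreover have "0 < (1 - t) * a + t * b"
      using that assms(2,3) by (cases "t = 0") (auto intro!: add_nonneg_pos)
    ultimately show ?thesis by simp
  qed
  have f': "(f has_real_derivative (b - a)) (at t within {0..1})" for t
    unfolding f_def by (auto intro!: derivative_eq_intros)
  have "smooth_curve A {0..1} (\<lambda>t. f t *\<^sub>T g0)"
  proof -
    \<comment> \<open>The successive derivatives of the affine function \<open>f\<close>.\<close>
    define F where "F k t = (if k = 0 then f t else if k = 1 then b - a else 0)" for k :: nat and t
    have "(F k has_real_derivative F (Suc k) t) (at t within {0..1})" for k t
      using f'[of t] by (cases k) (auto simp: F_def[abs_def])
    then have "smooth_curve A {0..1} (\<lambda>t. F 0 t *\<^sub>T g0)" by (intro smooth_curve_scalar g0_sym)
    then show ?thesis by (simp add: F_def)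
  qed
  then have mem: "(\<lambda>t. f t *\<^sub>T g0) \<in> ?S"
    using f by (auto simp: ray_def f_def)
  have "curve_length A (GP A P) 0 1 (\<lambda>t. f t *\<^sub>T g0)
      = (\<integral>\<^sup>+t\<in>{0..1}. ennreal \<bar>speed (f t) * (b - a)\<bar> \<partial>lborel)"
    by (rule ray_curve_length) (use f f' in auto)
  also have "\<dots> = ennreal \<bar>W (f 1) - W (f 0)\<bar>"
  proof (rule nn_integral_abs_derivative(2))
    show "((\<lambda>t. W (f t)) has_real_derivative speed (f t) * (b - a)) (at t within {0..1})" if "t \<in> {0..1}" for t
      by (rule Wf[OF f' f[OF that]])
    show "continuous_on {0..1} (\<lambda>t. speed (f t) * (b - a))"
      using DERIV_continuous_on[OF f'] f by (intro cont) auto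
    show "(\<forall>t\<in>{0..1}. 0 \<le> speed (f t) * (b - a)) \<or> (\<forall>t\<in>{0..1}. speed (f t) * (b - a) \<le> 0)"
      using less_imp_le[OF speed_pos[OF f]]
      by (cases "a \<le> b") (auto simp: zero_le_mult_iff mult_le_0_iff)
  qed
  also have "\<dots> = ennreal \<bar>W b - W a\<bar>" by (simp add: f_def)
  finally have "(INF c\<in>?S. curve_length A (GP A P) 0 1 c) = ennreal \<bar>W b - W a\<bar>"
    using lower mem by (intro antisym INF_greatest INF_lower2[of "\<lambda>t. f t *\<^sub>T g0"]) auto
  then show ?thesis by (simp add: path_dist_def)
qed

text \<open>No path in the ray joins such fields. The infimum over the empty set is \<open>\<infinity>\<close>, which
  \<^const>\<open>enn2real\<close> sends to \<open>0\<close>. The symmetry axiom of \<^locale>\<open>Metric_space\<close> also speaks of these pairs.\<close>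

lemma path_dist_off_ray:
  assumes "g \<notin> ray g0 \<or> h \<notin> ray g0"
  shows "path_dist A (GP A P) (ray g0) g h = 0"
proof -
  have "{c. smooth_curve A {0..1} c \<and> c ` {0..1} \<subseteq> ray g0 \<and> c 0 = g \<and> c (1::real) = h} = {}"
    using assms by (auto simp: image_subset_iff)
  then show ?thesis by (simp only: path_dist_def image_empty Inf_empty) simp
qed

lemma antiderivative_strict_mono:
  assumes W: "\<And>r. r > 0 \<Longrightarrow> (W has_real_derivative speed r) (at r)" and "0 < a" "a < b"
  shows "W a < W b"
proof (rule DERIV_pos_imp_increasing[OF assms(3)])
  fix x assume "a \<le> x" "x \<le> b"
  then show "\<exists>y. (W has_real_derivative y) (at x) \<and> 0 < y"
    using W[of x] speed_pos[of x] assms(2) by (intro exI[of _ "speed x"]) auto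
qed

lemma Metric_space_ray:
  "Metric_space (ray g0) (path_dist A (GP A P) (ray g0))" (is "Metric_space _ ?d")
proof -
  obtain W where W: "\<And>r. r > 0 \<Longrightarrow> (W has_real_derivative speed r) (at r)"
    using antiderivative_on_halfline[OF speed_continuous] by blast
  have dist: "?d (a *\<^sub>T g0) (b *\<^sub>T g0) = \<bar>W b - W a\<bar>" if "a > 0" "b > 0" for a b
    by (rule path_dist_ray) (use W that in auto)
  show ?thesis
  proof
    show "0 \<le> ?d x y" for x y by (simp add: path_dist_def)
    show "?d x y = ?d y x" for x y
    proof (cases "x \<in> ray g0 \<and> y \<in> ray g0")
      case True
      then obtain a b where "a > 0" "x = a *\<^sub>T g0" "b > 0" "y = b *\<^sub>T g0" by (auto simp: ray_def)
      then show ?thesis using dist[of a b] dist[of b a] by (simp add: abs_minus_commute)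
    next
      case False
      then show ?thesis using path_dist_off_ray[of x y] path_dist_off_ray[of y x] by auto
    qed
    show "?d x y = 0 \<longleftrightarrow> x = y" if xy: "x \<in> ray g0" "y \<in> ray g0" for x y
    proof -
      obtain a b where ab: "a > 0" "x = a *\<^sub>T g0" "b > 0" "y = b *\<^sub>T g0" using xy by (auto simp: ray_def)
      have "W a = W b \<longleftrightarrow> a = b"
        using antiderivative_strict_mono[OF W, of a b] antiderivative_strict_mono[OF W, of b a] ab
        by (cases a b rule: linorder_cases) auto
      then show ?thesis using dist[OF ab(1,3)] ab by (auto simp: g0_inject)
    qed
    show "?d x z \<le> ?d x y + ?d y z" if xyz: "x \<in> ray g0" "y \<in> ray g0" "z \<in> ray g0" for x y z
    proof -
      obtain a b c where "a > 0" "x = a *\<^sub>T g0" "b > 0" "y = b *\<^sub>T g0" "c > 0" "z = c *\<^sub>T g0"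
        using xyz by (auto simp: ray_def)
      then show ?thesis using dist[of a b] dist[of b c] dist[of a c] by simp
    qed
  qed
qed

text \<open>The metrics \<open>g0 / (k+1)\<close> form a Cauchy sequence. It stays at a positive distance from every
  \<open>r g0\<close>, since it eventually lies beyond \<open>(r/2) g0\<close>.\<close>

lemma not_mcomplete_ray:
  assumes W: "\<And>r. r > 0 \<Longrightarrow> (W has_real_derivative speed r) (at r)"
    and conv: "convergent (\<lambda>k. W (1 / real (Suc k)))"
  shows "\<not> Metric_space.mcomplete (ray g0) (path_dist A (GP A P) (ray g0))"
proof
  interpret M: Metric_space "ray g0" "path_dist A (GP A P) (ray g0)" by (rule Metric_space_ray)
  have dist: "path_dist A (GP A P) (ray g0) (a *\<^sub>T g0) (b *\<^sub>T g0) = \<bar>W b - W a\<bar>"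
    if "a > 0" "b > 0" for a b
    by (rule path_dist_ray) (use W that in auto)
  define \<sigma> where "\<sigma> k = (1 / real (Suc k)) *\<^sub>T g0" for k
  have "Cauchy (\<lambda>k. W (1 / real (Suc k)))" using conv by (rule convergent_Cauchy)
  moreover have "path_dist A (GP A P) (ray g0) (\<sigma> m) (\<sigma> n)
      = dist (W (1 / real (Suc m))) (W (1 / real (Suc n)))" for m n
    using dist[of "1 / real (Suc m)" "1 / real (Suc n)"] by (simp add: \<sigma>_def dist_real_def)
  moreover have "range \<sigma> \<subseteq> ray g0" by (auto simp: \<sigma>_def ray_def)
  ultimately have "M.MCauchy \<sigma>"
    unfolding M.MCauchy_def Cauchy_def by (simp only: simp_thms) blast
  moreover assume "M.mcomplete"
  ultimately obtain l where l: "limitin M.mtopology \<sigma> l sequentially"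
    unfolding M.mcomplete_def by blast
  then have "l \<in> ray g0" by (simp only: M.limitin_metric)
  then obtain r where r: "r > 0" "l = r *\<^sub>T g0" by (auto simp: ray_def)
  have gap: "0 < W r - W (r / 2)" using antiderivative_strict_mono[OF W, of "r / 2" r] r by simp
  then have "\<forall>\<^sub>F k in sequentially. path_dist A (GP A P) (ray g0) (\<sigma> k) l < W r - W (r / 2)"
    using l unfolding M.limitin_metric by (simp add: eventually_conj_iff)
  moreover have "\<forall>\<^sub>F k in sequentially. 1 / real (Suc k) < r / 2"
    using r by (intro order_tendstoD(2)[OF LIMSEQ_Suc[OF lim_1_over_n]]) auto
  ultimately have "\<forall>\<^sub>F k in sequentially. False"
  proof eventually_elim
    case (elim k)
    have "W (1 / real (Suc k)) < W (r / 2)"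
      by (rule antiderivative_strict_mono[OF W _ elim(2)]) auto
    then show ?case using elim(1) r dist[of "1 / real (Suc k)" r] by (simp add: \<sigma>_def)
  qed
  then show False by simp
qed

lemma speed_bound:
  assumes "\<Psi> \<in> O[at_right 0](\<lambda>r. r powr \<alpha>)"
  obtains \<delta> C where "\<delta> > 0"
    "\<And>r. 0 < r \<Longrightarrow> r \<le> \<delta> \<Longrightarrow> speed r \<le> C * r powr ((\<alpha> + real CARD('n) / 2 - 2) / 2)"
proof -
  obtain K where K: "K > 0" "\<forall>\<^sub>F r in at_right 0. norm (\<Psi> r) \<le> K * norm (r powr \<alpha>)"
    using landau_o.bigE[OF assms] by blast
  then obtain b where b: "b > 0" "\<And>r. 0 < r \<Longrightarrow> r < b \<Longrightarrow> \<bar>\<Psi> r\<bar> \<le> K * r powr \<alpha>"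
    by (auto simp: eventually_at_right_field)
  have "speed r \<le> sqrt (real CARD('n) * Vol A g0 * K) * r powr ((\<alpha> + real CARD('n) / 2 - 2) / 2)"
    if r: "0 < r" "r \<le> b / 2" for r
  proof -
    have "\<Psi> r \<le> K * r powr \<alpha>" using b(2)[of r] b(1) r by simp
    then have "speed r \<le> sqrt (real CARD('n) * Vol A g0 * ((K * r powr \<alpha>) * r powr (real CARD('n) / 2 - 2)))"
      unfolding speed_def using Vol_pos
      by (intro real_sqrt_le_mono mult_left_mono mult_right_mono) auto
    also have "\<dots> = sqrt (real CARD('n) * Vol A g0 * K) * sqrt (r powr (\<alpha> + real CARD('n) / 2 - 2))"
      by (simp add: powr_add[symmetric] real_sqrt_mult[symmetric] algebra_simps)
    also have "sqrt (r powr (\<alpha> + real CARD('n) / 2 - 2)) = r powr ((\<alpha> + real CARD('n) / 2 - 2) / 2)"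
      by (simp add: powr_half_sqrt[symmetric] powr_powr)
    finally show ?thesis .
  qed
  then show ?thesis using that[of "b / 2"] b(1) by auto
qed

lemma speed_antiderivative_convergent:
  assumes "\<alpha> > - real CARD('n) / 2" "\<Psi> \<in> O[at_right 0](\<lambda>r. r powr \<alpha>)"
    and W: "\<And>r. r > 0 \<Longrightarrow> (W has_real_derivative speed r) (at r)"
  shows "convergent (\<lambda>k. W (1 / real (Suc k)))"
proof -
  obtain \<delta> C where b: "\<delta> > 0"
    "\<And>r. 0 < r \<Longrightarrow> r \<le> \<delta> \<Longrightarrow> speed r \<le> C * r powr ((\<alpha> + real CARD('n) / 2 - 2) / 2)"
    using speed_bound[OF assms(2)] by blast
  show ?thesis
    by (rule integrable_power_antiderivative_converges[OF W speed_pos b]) (use assms(1) in simp_all)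
qed

lemma length_of_ray:
  "curve_length A (GP A P) 0 1 (\<lambda>r. r *\<^sub>T g0)
     = ennreal (sqrt (real CARD('n) * Vol A g0)) *
       (\<integral>\<^sup>+r\<in>{0..1}. ennreal (sqrt (\<Psi> r * r powr (real CARD('n) / 2 - 2))) \<partial>lborel)"
proof -
  let ?w = "\<lambda>r. sqrt (\<Psi> r * r powr (real CARD('n) / 2 - 2))"
  have "continuous_on {0<..} ?w"
    by (intro continuous_on_real_sqrt continuous_on_mult continuous_at_imp_continuous_on[of _ \<Psi>] continuous_on_powr
        ballI DERIV_isCont[OF \<Psi>_differentiable]) (auto intro!: continuous_intros)
  then have "(\<lambda>r. indicator {0<..} r *\<^sub>R ?w r) \<in> borel_measurable borel"
    by (intro borel_measurable_continuous_on_indicator) auto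
  then have meas: "(\<lambda>r. ennreal (indicator {0<..} r *\<^sub>R ?w r) * indicator {0..1} r) \<in> borel_measurable lborel"
    by simp
  \<comment> \<open>At \<open>r = 0\<close> the curve leaves the space of metrics, and \<open>\<Psi> 0\<close> is arbitrary.\<close>
  have AE: "AE r in lborel. r \<noteq> (0::real)" by (rule AE_lborel_singleton)
  have deriv: "curve_deriv A {0..1} (\<lambda>r. r *\<^sub>T g0) t = 1 *\<^sub>T g0" if "t \<in> {0..1}" for t
    by (rule curve_deriv_eq[OF has_curve_deriv_scalar_on[OF g0_sym DERIV_ident that refl]])
      (use that in \<open>simp add: trivial_limit_within islimpt_Icc\<close>)
  have "curve_length A (GP A P) 0 1 (\<lambda>r. r *\<^sub>T g0)
    = (\<integral>\<^sup>+r. ennreal (sqrt (real CARD('n) * Vol A g0)) *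
        (ennreal (indicator {0<..} r *\<^sub>R ?w r) * indicator {0..1} r) \<partial>lborel)"
    unfolding curve_length_def
  proof (rule nn_integral_cong_AE, use AE in eventually_elim)
    case (elim r)
    show ?case
    proof (cases "r \<in> {0..1}")
      case True
      then have "r > 0" using elim by simp
      have "sqrt (GP A P (r *\<^sub>T g0) (1 *\<^sub>T g0) (1 *\<^sub>T g0)) = sqrt (real CARD('n) * Vol A g0) * ?w r"
        by (simp add: GP_ray[OF \<open>r > 0\<close>] real_sqrt_mult)
      then show ?thesis using True \<open>r > 0\<close> Vol_pos \<Psi>_pos[OF \<open>r > 0\<close>]
        by (simp add: deriv ennreal_mult)
    qed simp
  qed
  also have "\<dots> = ennreal (sqrt (real CARD('n) * Vol A g0)) *
      (\<integral>\<^sup>+r. ennreal (indicator {0<..} r *\<^sub>R ?w r) * indicator {0..1} r \<partial>lborel)"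
    by (rule nn_integral_cmult[OF meas])
  also have "(\<integral>\<^sup>+r. ennreal (indicator {0<..} r *\<^sub>R ?w r) * indicator {0..1} r \<partial>lborel)
      = (\<integral>\<^sup>+r\<in>{0..1}. ennreal (?w r) \<partial>lborel)"
    by (rule nn_integral_cong_AE, use AE in eventually_elim) (auto simp: indicator_def)
  finally show ?thesis .
qed

end

section \<open>Total geodesy and the adjoint\<close>

locale conformal_ray_adjoint = conformal_ray A p P g0 \<Psi>
  for A :: "('a::t2_space, 'n::finite) chart set" and p P g0 \<Psi> +
  fixes Adj :: "('a, 'n) field \<Rightarrow> ('a, 'n) field \<Rightarrow> ('a, 'n) field \<Rightarrow> ('a, 'n) field"
  assumes adjoint: "is_adjoint A P Adj"
begin

lemma
  assumes "g \<in> metrics A" "h \<in> sym_fields A"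
  shows Adj_linear1: "linear_on_fields A (\<lambda>k. Adj g k h)"
    and Adj_linear2: "linear_on_fields A (Adj g h)"
  using adjoint assms unfolding is_adjoint_def smooth_bilinear_field_def by blast+

lemma Adj_adjoint:
  "g \<in> metrics A \<Longrightarrow> h \<in> sym_fields A \<Longrightarrow> k \<in> sym_fields A \<Longrightarrow> m \<in> sym_fields A \<Longrightarrow>
    tilde_g02 A g (dir_deriv A P g m h) k = tilde_g02 A g m (Adj g h k)"
  using adjoint unfolding is_adjoint_def by blast

lemma Adj_sym: "g \<in> metrics A \<Longrightarrow> h \<in> sym_fields A \<Longrightarrow> k \<in> sym_fields A \<Longrightarrow> Adj g h k \<in> sym_fields A"
  using Adj_linear2 unfolding linear_on_fields_def by blast

lemma Adj_scale:
  assumes "g \<in> metrics A"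
  shows "Adj g (a *\<^sub>T g0) (b *\<^sub>T g0) = (a * b) *\<^sub>T Adj g g0 g0"
proof -
  have "Adj g (a *\<^sub>T g0) (b *\<^sub>T g0) = b *\<^sub>T Adj g (a *\<^sub>T g0) g0"
    by (rule linear_on_fields_scale[OF Adj_linear2[OF assms sym_fields_scale[OF g0_sym]] g0_sym])
  also have "Adj g (a *\<^sub>T g0) g0 = a *\<^sub>T Adj g g0 g0"
    by (rule linear_on_fields_scale[OF Adj_linear1[OF assms g0_sym] g0_sym])
  finally show ?thesis by (simp only: tscale_algebra mult.commute[of a b])
qed

lemma dir_deriv_ray:
  assumes "r > 0"
  shows "dir_deriv A P (r *\<^sub>T g0) (a *\<^sub>T g0) (b *\<^sub>T g0) = (a * b * deriv \<Psi> r) *\<^sub>T g0"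
  unfolding dir_deriv_def
proof (rule curve_deriv_eq[OF has_curve_deriv_scalar[OF g0_sym, where \<phi> = "\<lambda>t. b * \<Psi> (r + t * a)"]])
  have "((\<lambda>t. r + t * a) has_real_derivative a) (at 0)"
    by (auto intro!: derivative_eq_intros)
  moreover have "(\<Psi> has_real_derivative deriv \<Psi> r) (at (r + 0 * a))"
    using \<Psi>_differentiable[OF assms] by simp
  ultimately have "((\<lambda>t. \<Psi> (r + t * a)) has_real_derivative deriv \<Psi> r * a) (at 0)"
    by (intro DERIV_chain2[where f = \<Psi>])
  then show "((\<lambda>t. b * \<Psi> (r + t * a)) has_real_derivative a * b * deriv \<Psi> r) (at 0)"
    using DERIV_cmult[of "\<lambda>t. \<Psi> (r + t * a)" "deriv \<Psi> r * a" 0 UNIV b] by (simp add: mult_ac)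
  have eq: "P (r *\<^sub>T g0 + t *\<^sub>T a *\<^sub>T g0) (b *\<^sub>T g0) = (b * \<Psi> (r + t * a)) *\<^sub>T g0" if "0 < r + t * a" for t
    using P_ray[OF that, of b] by (simp add: tscale_algebra)
  have "((\<lambda>t. r + t * a) \<longlongrightarrow> r + 0 * a) (at 0)" by (intro tendsto_intros)
  then have "\<forall>\<^sub>F t in at 0. 0 < r + t * a"
    using assms by (intro order_tendstoD(1)) auto
  then show "\<forall>\<^sub>F t in at 0. P (r *\<^sub>T g0 + t *\<^sub>T a *\<^sub>T g0) (b *\<^sub>T g0) = (b * \<Psi> (r + t * a)) *\<^sub>T g0"
    by (rule eventually_mono) (rule eq)
  show "P (r *\<^sub>T g0 + 0 *\<^sub>T a *\<^sub>T g0) (b *\<^sub>T g0) = (b * \<Psi> (r + 0 * a)) *\<^sub>T g0"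
    using eq[of 0] assms by simp
qed simp

lemma g0_outside: "e \<notin> A \<or> x \<notin> fst e \<Longrightarrow> g0 e x = 0"
  by (rule sym_field_outside[OF g0_sym])

lemma g0_function_mult:
  assumes "\<And>x. x \<in> carrier A \<Longrightarrow> \<phi> x = s"
  shows "\<phi> \<cdot>\<^sub>T (r *\<^sub>T g0) = (s * r) *\<^sub>T g0"
proof (rule field_eqI)
  fix e x
  show "(\<phi> \<cdot>\<^sub>T (r *\<^sub>T g0)) e x = ((s * r) *\<^sub>T g0) e x"
  proof (cases "e \<in> A \<and> x \<in> fst e")
    case True
    then show ?thesis using assms[OF domain_subset_carrier[of e x]] by simp
  next
    case False
    then show ?thesis using g0_outside[of e x] by simp
  qed
qed

lemma g02_ray:
  assumes "r > 0" "x \<in> carrier A"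
  shows "g02 A (r *\<^sub>T g0) (a *\<^sub>T g0) (b *\<^sub>T g0) x = a * b * real CARD('n) / r\<^sup>2"
proof -
  have "invertible (g0 (chart_at A x) x)"
    using chart_at[OF assms(2)] metric_invertible[OF g0_metric] by blast
  then show ?thesis using assms(1)
    by (simp add: g02_def Let_def matrix_inv_scaleR matrix_matrix_mult_scaleR trace_scaleR
        matrix_inv_inverse trace_I power2_eq_square)
qed

lemma tr_ray:
  assumes "r > 0" "x \<in> carrier A"
  shows "tr A (r *\<^sub>T g0) (a *\<^sub>T g0) x = a * real CARD('n) / r"
proof -
  have "invertible (g0 (chart_at A x) x)"
    using chart_at[OF assms(2)] metric_invertible[OF g0_metric] by blast
  then show ?thesis using assms(1)
    by (simp add: tr_def Let_def matrix_inv_scaleR matrix_matrix_mult_scaleR trace_scaleR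
        matrix_inv_inverse trace_I)
qed

lemma gprod_ray:
  assumes "r > 0"
  shows "gprod (r *\<^sub>T g0) (a *\<^sub>T g0) (b *\<^sub>T g0) = (a * b / r) *\<^sub>T g0"
proof (rule field_eqI)
  fix e x
  show "gprod (r *\<^sub>T g0) (a *\<^sub>T g0) (b *\<^sub>T g0) e x = ((a * b / r) *\<^sub>T g0) e x"
  proof (cases "e \<in> A \<and> x \<in> fst e")
    case True
    then have "invertible (g0 e x)" using metric_invertible[OF g0_metric] by blast
    then show ?thesis using assms
      by (simp add: gprod_def matrix_inv_scaleR matrix_matrix_mult_scaleR matrix_inv_inverse)
  next
    case False
    have "0 ** X = 0" for X :: "real^'n^'n" by (simp add: matrix_matrix_mult_def vec_eq_iff)
    then show ?thesis using g0_outside[of e x] False by (simp add: gprod_def)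
  qed
qed

lemma geodesic_rhs_ray:
  assumes "r > 0"
  shows "geodesic_rhs A P Adj (r *\<^sub>T g0) (h *\<^sub>T g0) =
    h\<^sup>2 *\<^sub>T ((1/2) *\<^sub>T Adj (r *\<^sub>T g0) g0 g0 + ((1 - real CARD('n) / 4) * \<Psi> r / r) *\<^sub>T g0)"
proof -
  let ?n = "real CARD('n)"
  have 1: "g02 A (r *\<^sub>T g0) ((h * \<Psi> r) *\<^sub>T g0) (h *\<^sub>T g0) \<cdot>\<^sub>T (r *\<^sub>T g0)
      = ((h * \<Psi> r * h * ?n / r\<^sup>2) * r) *\<^sub>T g0"
    by (rule g0_function_mult) (rule g02_ray[OF assms])
  have 2: "tr A (r *\<^sub>T g0) (h *\<^sub>T g0) \<cdot>\<^sub>T ((h * \<Psi> r) *\<^sub>T g0) = ((h * ?n / r) * (h * \<Psi> r)) *\<^sub>T g0"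
    by (rule g0_function_mult) (rule tr_ray[OF assms])
  have collect: "s *\<^sub>T q *\<^sub>T X + a *\<^sub>T a' *\<^sub>T g0 + b *\<^sub>T b' *\<^sub>T g0 + c *\<^sub>T c' *\<^sub>T g0 - d *\<^sub>T d' *\<^sub>T g0
      = (s * q) *\<^sub>T X + (a * a' + b * b' + c * c' - d * d') *\<^sub>T g0" for s q a a' b b' c c' d d' X
    by (intro field_eqI) (simp add: algebra_simps)
  have coeff: "1/4 * (h * \<Psi> r * h * ?n / r\<^sup>2 * r) + 1/2 * (h * (h * \<Psi> r) / r) + 1/2 * (h * \<Psi> r * h / r)
      - 1/2 * (h * ?n / r * (h * \<Psi> r)) = h\<^sup>2 * ((1 - ?n / 4) * \<Psi> r / r)"
    using assms by (simp add: field_simps power2_eq_square)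
  show ?thesis
    unfolding geodesic_rhs_def P_ray[OF assms] 1 2 gprod_ray[OF assms] Adj_scale[OF ray_metric[OF assms]]
      collect coeff
    by (intro field_eqI) (simp add: algebra_simps power2_eq_square)
qed

lemma P_inverse_scale:
  assumes "r > 0" "k \<in> sym_fields A"
  shows "inv_into (sym_fields A) (P (r *\<^sub>T g0)) (s *\<^sub>T k) = s *\<^sub>T inv_into (sym_fields A) (P (r *\<^sub>T g0)) k"
proof -
  note bij = P_bij[OF ray_metric[OF assms(1)]]
  let ?u = "inv_into (sym_fields A) (P (r *\<^sub>T g0)) k"
  have k: "k \<in> P (r *\<^sub>T g0) ` sym_fields A" using bij assms(2) by (simp add: bij_betw_def)
  have u: "?u \<in> sym_fields A" "P (r *\<^sub>T g0) ?u = k"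
    by (rule inv_into_into[OF k], rule f_inv_into_f[OF k])
  show ?thesis
    by (rule inv_into_f_eq[OF bij_betw_imp_inj_on[OF bij] sym_fields_scale[OF u(1)]])
       (simp add: linear_on_fields_scale[OF P_linear[OF ray_metric[OF assms(1)]] u(1)] u(2))
qed

lemma line_iff: "k \<in> line g0 \<longleftrightarrow> (\<exists>s. k = s *\<^sub>T g0)"
  by (auto simp: line_def)

lemma P_inverse_line:
  assumes "r > 0" "k \<in> sym_fields A"
  shows "inv_into (sym_fields A) (P (r *\<^sub>T g0)) k \<in> line g0 \<longleftrightarrow> k \<in> line g0"
proof -
  note bij = P_bij[OF ray_metric[OF assms(1)]]
  have k: "k \<in> P (r *\<^sub>T g0) ` sym_fields A" using bij assms(2) by (simp add: bij_betw_def)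
  show ?thesis
  proof
    assume "inv_into (sym_fields A) (P (r *\<^sub>T g0)) k \<in> line g0"
    then obtain s where "inv_into (sym_fields A) (P (r *\<^sub>T g0)) k = s *\<^sub>T g0" by (auto simp: line_iff)
    then have "k = P (r *\<^sub>T g0) (s *\<^sub>T g0)" using f_inv_into_f[OF k] by simp
    then show "k \<in> line g0" by (auto simp: P_ray[OF assms(1)] line_iff)
  next
    assume "k \<in> line g0"
    then obtain s where s: "k = s *\<^sub>T g0" by (auto simp: line_iff)
    have "inv_into (sym_fields A) (P (r *\<^sub>T g0)) k = (s / \<Psi> r) *\<^sub>T g0"
      by (rule inv_into_f_eq[OF bij_betw_imp_inj_on[OF bij] sym_fields_scale[OF g0_sym]])
         (use \<Psi>_pos[OF assms(1)] in \<open>simp add: P_ray[OF assms(1)] s\<close>)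
    then show "inv_into (sym_fields A) (P (r *\<^sub>T g0)) k \<in> line g0" by (auto simp: line_iff)
  qed
qed

text \<open>On multiples of \<open>g0\<close> the quadratic form that defines \<open>\<Gamma>\<close> is \<open>h\<^sup>2 P\<^sup>-\<^sup>1(1/2 Adj(g0, g0) + \<kappa> g0)\<close>: all
  terms of the geodesic equation other than the adjoint are themselves multiples of \<open>g0\<close>. Since \<open>P\<close> and
  \<open>P\<^sup>-\<^sup>1\<close> preserve the line \<open>\<real> g0\<close>, only the adjoint decides whether \<open>\<Gamma>\<close> is tangent to the ray.\<close>

lemma christoffel_ray:
  assumes "r > 0"
  obtains u where "\<And>a b. christoffel A P Adj (r *\<^sub>T g0) (a *\<^sub>T g0) (b *\<^sub>T g0) = (a * b) *\<^sub>T u"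
    "u \<in> line g0 \<longleftrightarrow> Adj (r *\<^sub>T g0) g0 g0 \<in> line g0"
proof -
  let ?A = "Adj (r *\<^sub>T g0) g0 g0"
  define \<kappa> where "\<kappa> = (1 - real CARD('n) / 4) * \<Psi> r / r - deriv \<Psi> r"
  define R where "R = (1/2) *\<^sub>T ?A + \<kappa> *\<^sub>T g0"
  have R: "R \<in> sym_fields A"
    unfolding R_def by (intro sym_fields_add sym_fields_scale g0_sym Adj_sym ray_metric assms)
  define u where "u = inv_into (sym_fields A) (P (r *\<^sub>T g0)) R"
  have quad: "christoffel_quad A P Adj (r *\<^sub>T g0) (h *\<^sub>T g0) = h\<^sup>2 *\<^sub>T u" for h
  proof -
    have "geodesic_rhs A P Adj (r *\<^sub>T g0) (h *\<^sub>T g0) - dir_deriv A P (r *\<^sub>T g0) (h *\<^sub>T g0) (h *\<^sub>T g0)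
        = h\<^sup>2 *\<^sub>T R"
      unfolding geodesic_rhs_ray[OF assms] dir_deriv_ray[OF assms] R_def \<kappa>_def
      by (intro field_eqI) (simp add: power2_eq_square algebra_simps)
    then show ?thesis
      unfolding christoffel_quad_def u_def by (simp add: P_inverse_scale[OF assms R])
  qed
  show ?thesis
  proof (rule that[of u])
    fix a b
    have "christoffel A P Adj (r *\<^sub>T g0) (a *\<^sub>T g0) (b *\<^sub>T g0)
        = (1/2) *\<^sub>T ((a + b)\<^sup>2 *\<^sub>T u - a\<^sup>2 *\<^sub>T u - b\<^sup>2 *\<^sub>T u)"
      unfolding christoffel_def by (simp add: tscale_algebra(5) quad)
    also have "\<dots> = (1/2 * ((a + b)\<^sup>2 - a\<^sup>2 - b\<^sup>2)) *\<^sub>T u"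
      by (simp only: tscale_algebra)
    also have "1/2 * ((a + b)\<^sup>2 - a\<^sup>2 - b\<^sup>2) = a * b" by (simp add: power2_eq_square algebra_simps)
    finally show "christoffel A P Adj (r *\<^sub>T g0) (a *\<^sub>T g0) (b *\<^sub>T g0) = (a * b) *\<^sub>T u" .
  next
    have "R \<in> line g0 \<longleftrightarrow> ?A \<in> line g0"
    proof
      assume "R \<in> line g0"
      then obtain s where s: "R = s *\<^sub>T g0" by (auto simp: line_iff)
      have "?A = 2 *\<^sub>T (R - \<kappa> *\<^sub>T g0)" by (auto simp: R_def intro!: field_eqI)
      then have "?A = (2 * (s - \<kappa>)) *\<^sub>T g0" by (simp only: s tscale_algebra)
      then show "?A \<in> line g0" by (auto simp: line_iff)
    next
      assume "?A \<in> line g0"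
      then obtain s where s: "?A = s *\<^sub>T g0" by (auto simp: line_iff)
      have "R = (1/2 * s + \<kappa>) *\<^sub>T g0" by (simp only: R_def s tscale_algebra)
      then show "R \<in> line g0" by (auto simp: line_iff)
    qed
    then show "u \<in> line g0 \<longleftrightarrow> ?A \<in> line g0" unfolding u_def P_inverse_line[OF assms R] .
  qed
qed

lemma totally_geodesic_iff:
  "ray_totally_geodesic A P Adj g0 \<longleftrightarrow> (\<forall>r>0. Adj (r *\<^sub>T g0) g0 g0 \<in> line g0)"
proof
  assume tg: "ray_totally_geodesic A P Adj g0"
  show "\<forall>r>0. Adj (r *\<^sub>T g0) g0 g0 \<in> line g0"
  proof (intro allI impI)
    fix r :: real assume r: "r > 0"
    obtain u where u: "\<And>a b. christoffel A P Adj (r *\<^sub>T g0) (a *\<^sub>T g0) (b *\<^sub>T g0) = (a * b) *\<^sub>T u"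
      and iff: "u \<in> line g0 \<longleftrightarrow> Adj (r *\<^sub>T g0) g0 g0 \<in> line g0"
      by (rule christoffel_ray[OF r]) blast
    have "r *\<^sub>T g0 \<in> ray g0" "1 *\<^sub>T g0 \<in> line g0" using r by (auto simp: ray_def line_iff)
    with tg have "christoffel A P Adj (r *\<^sub>T g0) (1 *\<^sub>T g0) (1 *\<^sub>T g0) \<in> line g0"
      unfolding ray_totally_geodesic_def by blast
    then show "Adj (r *\<^sub>T g0) g0 g0 \<in> line g0" unfolding u iff[symmetric] by (simp add: tscale_algebra)
  qed
next
  assume Adj: "\<forall>r>0. Adj (r *\<^sub>T g0) g0 g0 \<in> line g0"
  show "ray_totally_geodesic A P Adj g0"
    unfolding ray_totally_geodesic_def
  proof (intro ballI)
    fix g h k assume "g \<in> ray g0" "h \<in> line g0" "k \<in> line g0"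
    then obtain r a b where r: "r > 0" and eq: "g = r *\<^sub>T g0" "h = a *\<^sub>T g0" "k = b *\<^sub>T g0"
      unfolding ray_def line_def by blast
    obtain u where u: "\<And>a b. christoffel A P Adj (r *\<^sub>T g0) (a *\<^sub>T g0) (b *\<^sub>T g0) = (a * b) *\<^sub>T u"
      and iff: "u \<in> line g0 \<longleftrightarrow> Adj (r *\<^sub>T g0) g0 g0 \<in> line g0"
      by (rule christoffel_ray[OF r]) blast
    from iff Adj r obtain s where "u = s *\<^sub>T g0" by (auto simp: line_iff)
    then have "christoffel A P Adj g h k = (a * b * s) *\<^sub>T g0"
      unfolding eq u by (simp add: tscale_algebra)
    then show "christoffel A P Adj g h k \<in> line g0" by (auto simp: line_iff)
  qed
qed

text \<open>Let \<open>v\<close> be the component of \<open>u\<close> orthogonal to \<open>g0\<close>. Every symmetric field \<open>m\<close> is the sum of a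
  multiple of \<open>g0\<close> and a normal field, and \<open>v\<close> is orthogonal to both. Taking \<open>m = P v\<close>, positivity of
  \<open>P\<close> gives \<open>v = 0\<close>.\<close>

lemma double_orthogonal:
  assumes r: "r > 0" and u: "u \<in> sym_fields A"
    and orth: "\<And>m. m \<in> sym_fields A \<Longrightarrow> normal_to_ray A g0 (r *\<^sub>T g0) m \<Longrightarrow> tilde_g02 A (r *\<^sub>T g0) m u = 0"
  shows "u \<in> line g0"
proof -
  let ?g = "r *\<^sub>T g0"
  note g = ray_metric[OF r]
  let ?t = "tilde_g02 A ?g"
  have N: "?t g0 g0 > 0"
    using Vol_pos r by (simp add: tilde_g02_scale_metric[OF g0_metric r] tilde_g02_self[OF g0_metric])
  have normal: "normal_to_ray A g0 ?g m" if "?t m g0 = 0" for m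
    using that by (auto simp: normal_to_ray_def line_iff tilde_g02_scale_right)
  have zero: "?t m u = ?t m g0 * (?t u g0 / ?t g0 g0)" if m: "m \<in> sym_fields A" for m
  proof -
    let ?m = "(- (?t m g0 / ?t g0 g0)) *\<^sub>T g0 + m"
    have "?m \<in> sym_fields A" by (intro sym_fields_linear_combination g0_sym m)
    moreover have "?t ?m g0 = 0"
      using N by (simp add: tilde_g02_linear_left[OF g g0_sym m g0_sym])
    ultimately have "?t ?m u = 0" by (intro orth normal)
    then show ?thesis
      by (simp add: tilde_g02_linear_left[OF g g0_sym m u] tilde_g02_commute[of _ g0 u])
  qed
  define v where "v = (- (?t u g0 / ?t g0 g0)) *\<^sub>T g0 + u"
  have v: "v \<in> sym_fields A" unfolding v_def by (intro sym_fields_linear_combination g0_sym u)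
  have "?t m v = 0" if m: "m \<in> sym_fields A" for m
  proof -
    have "?t m v = ?t v m" by (rule tilde_g02_commute)
    also have "\<dots> = - (?t u g0 / ?t g0 g0) * ?t g0 m + ?t u m"
      unfolding v_def by (rule tilde_g02_linear_left[OF g g0_sym u m])
    also have "\<dots> = 0" using zero[OF m] by (simp add: tilde_g02_commute[of _ m g0] tilde_g02_commute[of _ m u])
    finally show ?thesis .
  qed
  moreover have "P ?g v \<in> sym_fields A" using P_bij[OF g] v by (auto simp: bij_betw_def)
  ultimately have "?t (P ?g v) v = 0" by blast
  then have "v = 0" using P_positive[OF g v] by (cases "v = 0") auto
  moreover have "u = v + (?t u g0 / ?t g0 g0) *\<^sub>T g0"
    unfolding v_def by (intro field_eqI) simp
  ultimately have "u = (?t u g0 / ?t g0 g0) *\<^sub>T g0" by simp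
  then show ?thesis by (auto simp: line_iff)
qed

text \<open>The defining property of the adjoint turns the normality of \<open>(D\<^bsub>(g,m)\<^esub>P) h\<close> into orthogonality of
  \<open>m\<close> to \<open>Adj(g0, g0)\<close>.\<close>

lemma normal_condition_iff:
  "(\<forall>g\<in>ray g0. \<forall>h\<in>line g0. \<forall>m\<in>sym_fields A.
      normal_to_ray A g0 g m \<longrightarrow> normal_to_ray A g0 g (dir_deriv A P g m h))
    \<longleftrightarrow> (\<forall>r>0. Adj (r *\<^sub>T g0) g0 g0 \<in> line g0)"
  (is "?L \<longleftrightarrow> ?R")
proof -
  have adj: "tilde_g02 A (r *\<^sub>T g0) (dir_deriv A P (r *\<^sub>T g0) m (a *\<^sub>T g0)) (b *\<^sub>T g0)
     = a * b * tilde_g02 A (r *\<^sub>T g0) m (Adj (r *\<^sub>T g0) g0 g0)"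
    if "r > 0" "m \<in> sym_fields A" for r m a b
    using Adj_adjoint[OF ray_metric[OF that(1)] sym_fields_scale[OF g0_sym] sym_fields_scale[OF g0_sym] that(2), of a b]
    by (simp add: Adj_scale[OF ray_metric[OF that(1)]] tilde_g02_scale_right)
  show ?thesis
  proof
    assume L: ?L
    show ?R
    proof (intro allI impI)
      fix r :: real assume r: "r > 0"
      show "Adj (r *\<^sub>T g0) g0 g0 \<in> line g0"
      proof (rule double_orthogonal[OF r])
        show "Adj (r *\<^sub>T g0) g0 g0 \<in> sym_fields A" by (intro Adj_sym ray_metric r g0_sym)
        fix m assume m: "m \<in> sym_fields A" "normal_to_ray A g0 (r *\<^sub>T g0) m"
        have "r *\<^sub>T g0 \<in> ray g0" "1 *\<^sub>T g0 \<in> line g0" using r by (auto simp: ray_def line_iff)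
        with L m have "normal_to_ray A g0 (r *\<^sub>T g0) (dir_deriv A P (r *\<^sub>T g0) m (1 *\<^sub>T g0))" by blast
        then have "tilde_g02 A (r *\<^sub>T g0) (dir_deriv A P (r *\<^sub>T g0) m (1 *\<^sub>T g0)) (1 *\<^sub>T g0) = 0"
          unfolding normal_to_ray_def using \<open>1 *\<^sub>T g0 \<in> line g0\<close> by blast
        then show "tilde_g02 A (r *\<^sub>T g0) m (Adj (r *\<^sub>T g0) g0 g0) = 0"
          unfolding adj[OF r m(1)] by simp
      qed
    qed
  next
    assume R: ?R
    show ?L
    proof (intro ballI impI)
      fix g h m assume gh: "g \<in> ray g0" "h \<in> line g0" and m: "m \<in> sym_fields A" "normal_to_ray A g0 g m"
      from gh obtain r a where r: "r > 0" and eq: "g = r *\<^sub>T g0" "h = a *\<^sub>T g0"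
        unfolding ray_def line_def by blast
      have "tilde_g02 A g m (Adj (r *\<^sub>T g0) g0 g0) = 0"
        using R r m(2) unfolding normal_to_ray_def by blast
      then show "normal_to_ray A g0 g (dir_deriv A P g m h)"
        unfolding normal_to_ray_def eq using adj[OF r m(1), of a] by (auto simp: line_iff)
    qed
  qed
qed

text \<open>The defining property of the adjoint, with \<open>g0\<close> for all three fields, determines the coefficient.\<close>

lemma Adj_coefficient:
  assumes "r > 0" "Adj (r *\<^sub>T g0) g0 g0 \<in> line g0"
  shows "Adj (r *\<^sub>T g0) g0 g0 = deriv \<Psi> r *\<^sub>T g0"
proof -
  obtain s where s: "Adj (r *\<^sub>T g0) g0 g0 = s *\<^sub>T g0" using assms(2) by (auto simp: line_iff)
  let ?t = "tilde_g02 A (r *\<^sub>T g0)"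
  have N: "?t g0 g0 > 0"
    using Vol_pos assms(1)
    by (simp add: tilde_g02_scale_metric[OF g0_metric assms(1)] tilde_g02_self[OF g0_metric])
  have "?t (dir_deriv A P (r *\<^sub>T g0) g0 g0) g0 = ?t g0 (s *\<^sub>T g0)"
    using Adj_adjoint[OF ray_metric[OF assms(1)] g0_sym g0_sym g0_sym] by (simp add: s)
  moreover have "dir_deriv A P (r *\<^sub>T g0) g0 g0 = deriv \<Psi> r *\<^sub>T g0"
    using dir_deriv_ray[OF assms(1), of 1 1] by (simp add: tscale_algebra)
  ultimately show ?thesis using N s by (simp add: tilde_g02_scale_left tilde_g02_scale_right)
qed

end

section \<open>The arc length geodesic\<close>

context conformal_ray
begin

lemma speed_derivative:
  assumes "r > 0"
  shows "((\<lambda>r. inverse (speed r)) has_real_derivative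
    - (1/2) * inverse (speed r) * (deriv \<Psi> r / \<Psi> r + (real CARD('n) / 2 - 2) / r)) (at r)"
proof -
  let ?e = "real CARD('n) / 2 - 2" and ?K = "real CARD('n) * Vol A g0"
  define q where "q r = ?K * (\<Psi> r * r powr ?e)" for r
  define D where "D = deriv \<Psi> r / \<Psi> r + ?e / r"
  have q: "q r > 0" using Vol_pos \<Psi>_pos[OF assms] assms by (simp add: q_def)
  have "(q has_real_derivative ?K * (\<Psi> r * (?e * r powr (?e - 1)) + deriv \<Psi> r * r powr ?e)) (at r)"
    unfolding q_def
    by (intro DERIV_cmult DERIV_mult' has_real_derivative_powr \<Psi>_differentiable assms)
  moreover have "?K * (\<Psi> r * (?e * r powr (?e - 1)) + deriv \<Psi> r * r powr ?e) = q r * D"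
  proof -
    have pm: "r powr (?e - 1) = r powr ?e / r"
      using assms powr_diff[of r ?e 1] powr_one[of r] by (simp only: less_imp_le)
    have "K * (\<psi> * (e * (x / r)) + \<psi>' * x) = K * (\<psi> * x) * (\<psi>' / \<psi> + e / r)"
      if "\<psi> > 0" for K \<psi> e x \<psi>' :: real
      using that assms by (simp add: field_simps)
    then show ?thesis unfolding pm q_def D_def using \<Psi>_pos[OF assms] by blast
  qed
  ultimately have dq: "(q has_real_derivative q r * D) (at r)" by simp
  have "(speed has_real_derivative inverse (sqrt (q r)) / 2 * (q r * D)) (at r)"
    unfolding speed_def[abs_def] q_def[symmetric]
    by (rule DERIV_chain2[OF DERIV_real_sqrt[OF q] dq])
  moreover have s: "speed r = sqrt (q r)" by (simp add: speed_def q_def)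
  moreover have "inverse (sqrt (q r)) * q r = sqrt (q r)"
    using q by (simp add: field_simps)
  ultimately have ds: "(speed has_real_derivative speed r * D / 2) (at r)"
    by (simp add: mult.assoc[symmetric])
  have "((\<lambda>r. inverse (speed r)) has_real_derivative - (inverse (speed r) * (speed r * D / 2) * inverse (speed r))) (at r)"
    by (rule DERIV_inverse'[OF ds]) (use speed_pos[OF assms] in simp)
  moreover have "- (inverse (speed r) * (speed r * D / 2) * inverse (speed r)) = - (1/2) * inverse (speed r) * D"
    using speed_pos[OF assms] by simp
  ultimately show ?thesis unfolding D_def by (simp only:)
qed

lemma speed_inverse_smooth: "times_differentiable k {0<..} (\<lambda>r. inverse (speed r))"
proof -
  define q where "q r = real CARD('n) * Vol A g0 * (\<Psi> r * r powr (real CARD('n) / 2 - 2))" for r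
  have q: "q r > 0" if "r > 0" for r using that Vol_pos \<Psi>_pos[of r] by (simp add: q_def)
  have "times_differentiable k {0<..} q"
    unfolding q_def by (rule times_differentiable_mult[OF times_differentiable_const times_differentiable_mult[OF \<Psi>_smooth times_differentiable_powr]])
  then have smooth: "times_differentiable k {0<..} (\<lambda>r. q r powr (- (1/2)))"
    by (rule times_differentiable_compose[OF times_differentiable_powr]) (use q in auto)
  have "q r powr (- (1/2)) = inverse (speed r)" if "r \<in> {0<..}" for r
    using q[of r] that unfolding powr_minus by (simp add: powr_half_sqrt q_def speed_def)
  from times_differentiable_cong[OF open_greaterThan this smooth] show ?thesis .
qed

text \<open>The inverse of the arc length function \<open>W\<close> parametrizes the ray with unit speed. It solves the
  autonomous equation \<open>f' = 1 / speed(f)\<close>, whose right hand side is smooth.\<close>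

lemma arc_length_parametrization:
  assumes W: "\<And>r. r > 0 \<Longrightarrow> (W has_real_derivative speed r) (at r)"
  defines "I \<equiv> W ` {0<..}"
  obtains f where "open I" "is_interval I" "\<And>r. r > 0 \<Longrightarrow> f (W r) = r" "\<And>t. t \<in> I \<Longrightarrow> f t > 0"
    "\<And>t. t \<in> I \<Longrightarrow> (f has_real_derivative inverse (speed (f t))) (at t)" "\<And>k. times_differentiable k I f"
proof -
  have cont: "continuous_on {0<..} W"
    by (intro continuous_at_imp_continuous_on ballI DERIV_isCont[OF W]) simp
  have inj: "inj_on W {0<..}"
  proof (rule linorder_inj_onI')
    fix a b :: real assume "a \<in> {0<..}" "b \<in> {0<..}" "a < b"
    then show "W a \<noteq> W b" using antiderivative_strict_mono[OF W, of a b] by simp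
  qed
  define f where "f = inv_into {0<..} W"
  have fW: "f (W r) = r" if "r > 0" for r
    unfolding f_def by (rule inv_into_f_f[OF inj]) (use that in simp)
  have fpos: "f t > 0" if "t \<in> I" for t using that fW by (auto simp: I_def)
  have der: "(f has_real_derivative inverse (speed (f t))) (at t)" if "t \<in> I" for t
  proof -
    obtain r where r: "r > 0" "t = W r" using \<open>t \<in> I\<close> by (auto simp: I_def)
    have "(W has_derivative (\<lambda>x. speed r * x)) (at r)"
      using W[OF r(1)] by (simp add: has_field_derivative_def)
    moreover have "(\<lambda>x. speed r * x) \<circ> (\<lambda>x. inverse (speed r) * x) = id"
      using speed_pos[OF r(1)] by (auto simp: fun_eq_iff)
    ultimately have "(f has_derivative (\<lambda>x. inverse (speed r) * x)) (at (W r))"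
      using has_derivative_inverse_strong[of "{0<..}" r W f] cont fW r(1) by simp
    then show ?thesis using fW r by (simp add: has_field_derivative_def)
  qed
  show ?thesis
  proof (rule that)
    show "open I" unfolding I_def by (rule invariance_of_domain[OF cont _ inj]) simp
    show "is_interval I" unfolding I_def is_interval_connected_1
      by (rule connected_continuous_image[OF cont]) simp
    show "times_differentiable k I f" for k
      by (rule times_differentiable_autonomous_ode[OF speed_inverse_smooth _ der]) (use fpos in auto)
  qed (use fW fpos der in auto)
qed

text \<open>A smooth curve of metrics cannot run into the zero tensor: its matrix entries are continuous, and
  a metric has a nonzero one.\<close>

lemma not_metric_limit:
  assumes "smooth_curve A UNIV c" "\<And>t. c t \<in> metrics A" "\<And>k. c (\<tau> k) = \<rho> k *\<^sub>T g0"
    "\<tau> \<longlonglongrightarrow> (L::real)" "\<rho> \<longlonglongrightarrow> 0"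
  shows False
proof -
  obtain e x i j where e: "e \<in> A" "x \<in> fst e" and nz: "c L e x $ i $ j \<noteq> 0"
    by (rule metric_nonzero_entry[OF assms(2)]) (rule that)
  obtain d where d0: "\<And>t. d 0 t = c t" and d: "\<And>k t. has_curve_deriv A UNIV (d k) (d (Suc k) t) t"
    using assms(1) unfolding smooth_curve_def by auto
  have "isCont (\<lambda>t. d 0 t e x $ i $ j) L"
    by (rule DERIV_isCont[OF has_curve_deriv_entry[OF d e]])
  then have "(\<lambda>k. c (\<tau> k) e x $ i $ j) \<longlonglongrightarrow> c L e x $ i $ j"
    unfolding d0 by (rule isCont_tendsto_compose[OF _ assms(4)])
  moreover have "(\<lambda>k. c (\<tau> k) e x $ i $ j) \<longlonglongrightarrow> 0 * g0 e x $ i $ j"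
    unfolding assms(3) by (simp, intro tendsto_mult_left_zero assms(5))
  ultimately show False using nz LIMSEQ_unique by fastforce
qed

end

context conformal_ray_adjoint
begin

text \<open>With \<open>Adj(g0, g0) = \<Psi>' g0\<close> both sides of the geodesic equation are multiples of \<open>g0\<close>. With \<open>r = f(t)\<close>
  and \<open>h = f'(t) = 1 / speed(r)\<close>, the equation says that the function \<open>\<Psi> / speed\<close> has derivative
  \<open>h (\<Psi>' / 2 + (1 - n/4) \<Psi> / r)\<close> at \<open>r\<close>. This
  follows by logarithmic differentiation of \<open>speed\<^sup>2 = n Vol(g0) \<Psi> r\<^bsup>n/2 - 2\<^esup>\<close>.\<close>

lemma arc_length_curve_geodesic:
  assumes tg: "ray_totally_geodesic A P Adj g0" and I: "open I"
    and f: "\<And>t. t \<in> I \<Longrightarrow> f t > 0"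
    and f': "\<And>t. t \<in> I \<Longrightarrow> (f has_real_derivative inverse (speed (f t))) (at t)"
    and smooth: "\<And>k. times_differentiable k I f"
  shows "geodesic A P Adj I (\<lambda>t. f t *\<^sub>T g0)"
  unfolding geodesic_def
proof (intro conjI ballI)
  let ?n = "real CARD('n)"
  have "smooth_curve A I (\<lambda>t. (deriv ^^ 0) f t *\<^sub>T g0)"
    by (rule smooth_curve_scalar[OF g0_sym, of I "\<lambda>k. (deriv ^^ k) f"])
      (rule has_field_derivative_at_within[OF higher_deriv_real[OF I smooth]])
  then show "smooth_curve A I (\<lambda>t. f t *\<^sub>T g0)" by simp
  show "(\<lambda>t. f t *\<^sub>T g0) ` I \<subseteq> metrics A" using f ray_metric by auto
  have cd: "curve_deriv A I (\<lambda>t. f t *\<^sub>T g0) t = inverse (speed (f t)) *\<^sub>T g0" if "t \<in> I" for t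
  proof (rule curve_deriv_eq)
    show "has_curve_deriv A I (\<lambda>t. f t *\<^sub>T g0) (inverse (speed (f t)) *\<^sub>T g0) t"
      by (rule has_curve_deriv_scalar_on[where \<phi> = f, OF g0_sym has_field_derivative_at_within[OF f'[OF that]] that])
        simp
    show "at t within I \<noteq> bot" by (simp only: at_within_open[OF that I] at_neq_bot) simp
  qed
  fix t assume t: "t \<in> I"
  define r where "r = f t"
  define h where "h = inverse (speed r)"
  have r: "r > 0" using f[OF t] by (simp add: r_def)
  have "Adj (r *\<^sub>T g0) g0 g0 = deriv \<Psi> r *\<^sub>T g0"
    using tg r by (intro Adj_coefficient) (auto simp: totally_geodesic_iff)
  then have rhs: "geodesic_rhs A P Adj (r *\<^sub>T g0) (h *\<^sub>T g0)
      = (h\<^sup>2 * (1/2 * deriv \<Psi> r + (1 - ?n / 4) * \<Psi> r / r)) *\<^sub>T g0"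
    unfolding geodesic_rhs_ray[OF r] by (simp only: tscale_algebra)
  have "((\<lambda>r. inverse (speed r) * \<Psi> r) has_real_derivative
      h * deriv \<Psi> r + (- (1/2) * h * (deriv \<Psi> r / \<Psi> r + (?n / 2 - 2) / r)) * \<Psi> r) (at (f t))"
    using DERIV_mult'[OF speed_derivative[OF r] \<Psi>_differentiable[OF r]] by (simp add: h_def r_def)
  then have "((\<lambda>t. inverse (speed (f t)) * \<Psi> (f t)) has_real_derivative
      (h * deriv \<Psi> r + (- (1/2) * h * (deriv \<Psi> r / \<Psi> r + (?n / 2 - 2) / r)) * \<Psi> r) * h) (at t)"
    by (rule DERIV_chain2) (use f'[OF t] in \<open>simp add: h_def r_def\<close>)
  moreover have "(h * deriv \<Psi> r + (- (1/2) * h * (deriv \<Psi> r / \<Psi> r + (?n / 2 - 2) / r)) * \<Psi> r) * h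
      = h\<^sup>2 * (1/2 * deriv \<Psi> r + (1 - ?n / 4) * \<Psi> r / r)"
    using r \<Psi>_pos[OF r] by (simp add: field_simps power2_eq_square)
  ultimately have D: "((\<lambda>t. inverse (speed (f t)) * \<Psi> (f t)) has_real_derivative
      h\<^sup>2 * (1/2 * deriv \<Psi> r + (1 - ?n / 4) * \<Psi> r / r)) (at t within I)"
    by (simp add: has_field_derivative_at_within)
  have "has_curve_deriv A I (\<lambda>s. P (f s *\<^sub>T g0) (curve_deriv A I (\<lambda>t. f t *\<^sub>T g0) s))
      ((h\<^sup>2 * (1/2 * deriv \<Psi> r + (1 - ?n / 4) * \<Psi> r / r)) *\<^sub>T g0) t"
    by (rule has_curve_deriv_scalar_on[OF g0_sym D t]) (simp add: cd P_ray[OF f])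
  then show "has_curve_deriv A I (\<lambda>s. P (f s *\<^sub>T g0) (curve_deriv A I (\<lambda>t. f t *\<^sub>T g0) s))
      (geodesic_rhs A P Adj (f t *\<^sub>T g0) (curve_deriv A I (\<lambda>t. f t *\<^sub>T g0) t)) t"
    by (simp only: cd[OF t] r_def[symmetric] h_def[symmetric] rhs)
qed

text \<open>The arc length curve reaches the tip of the cone, where the tensor vanishes, at the finite
  time \<open>L\<close>. So no curve of metrics defined at \<open>L\<close> extends it.\<close>

lemma ray_geodesically_incomplete:
  assumes tg: "ray_totally_geodesic A P Adj g0"
    and W: "\<And>r. r > 0 \<Longrightarrow> (W has_real_derivative speed r) (at r)"
    and conv: "convergent (\<lambda>k. W (1 / real (Suc k)))"
  shows "geodesically_incomplete A P Adj"
proof -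
  define I where "I = W ` {0<..}"
  obtain f where I: "open I" "is_interval I" and fW: "\<And>r. r > 0 \<Longrightarrow> f (W r) = r"
    and f: "\<And>t. t \<in> I \<Longrightarrow> f t > 0" "\<And>t. t \<in> I \<Longrightarrow> (f has_real_derivative inverse (speed (f t))) (at t)"
      "\<And>k. times_differentiable k I f"
    unfolding I_def by (rule arc_length_parametrization[OF W]) auto
  have geo: "geodesic A P Adj I (\<lambda>t. f t *\<^sub>T g0)"
    by (rule arc_length_curve_geodesic[OF tg I(1) f])
  obtain L where L: "(\<lambda>k. W (1 / real (Suc k))) \<longlonglongrightarrow> L" using conv by (auto simp: convergent_def)
  have False if c': "geodesic A P Adj UNIV c'" and ext: "\<forall>t\<in>I. c' t = f t *\<^sub>T g0" for c'
  proof (rule not_metric_limit[OF _ _ _ L LIMSEQ_Suc[OF lim_1_over_n]])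
    show "smooth_curve A UNIV c'" "\<And>t. c' t \<in> metrics A" using c' by (auto simp: geodesic_def)
    show "c' (W (1 / real (Suc k))) = (1 / real (Suc k)) *\<^sub>T g0" for k
      using ext fW[of "1 / real (Suc k)"] by (auto simp: I_def)
  qed
  moreover have "I \<noteq> {}" by (auto simp: I_def)
  ultimately show ?thesis
    unfolding geodesically_incomplete_def using I geo by blast
qed

end

theorem lemma3p5:
  fixes A :: "('a::t2_space, 'n::finite) chart set"
    and p :: real
    and P :: "('a, 'n) field \<Rightarrow> ('a, 'n) field \<Rightarrow> ('a, 'n) field"
    and Adj :: "('a, 'n) field \<Rightarrow> ('a, 'n) field \<Rightarrow> ('a, 'n) field \<Rightarrow> ('a, 'n) field"
    and g0 :: "('a, 'n) field"
    and \<Psi> :: "real \<Rightarrow> real"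
  assumes "compact_manifold A"
    and "admissible_operator A p P"
    and "is_adjoint A P Adj"
    and "g0 \<in> metrics A"
    and "\<And>r. r > 0 \<Longrightarrow> P (r *\<^sub>T g0) g0 = \<Psi> r *\<^sub>T g0"
  shows "curve_length A (GP A P) 0 1 (\<lambda>r. r *\<^sub>T g0)
           = ennreal (sqrt (real CARD('n) * Vol A g0)) *
             (\<integral>\<^sup>+r\<in>{0..1}. ennreal (sqrt (\<Psi> r * r powr (real CARD('n) / 2 - 2))) \<partial>lborel)
    \<and> (\<forall>\<alpha>. \<alpha> > - real CARD('n) / 2 \<and> \<Psi> \<in> O[at_right 0](\<lambda>r. r powr \<alpha>) \<longrightarrow>
          incomplete_metric_space (ray g0) (path_dist A (GP A P) (ray g0)) \<and>
          ((\<forall>g\<in>ray g0. \<forall>h\<in>line g0. P g h \<in> line g0) \<and> ray_totally_geodesic A P Adj g0 \<longrightarrow>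
             geodesically_incomplete A P Adj))
    \<and> ((\<forall>g\<in>ray g0. \<forall>h\<in>line g0. P g h \<in> line g0) \<longrightarrow>
          (ray_totally_geodesic A P Adj g0 \<longleftrightarrow>
             (\<forall>g\<in>ray g0. \<forall>h\<in>line g0. \<forall>m\<in>sym_fields A.
                normal_to_ray A g0 g m \<longrightarrow> normal_to_ray A g0 g (dir_deriv A P g m h))))"
proof -
  interpret conformal_ray_adjoint A p P g0 \<Psi> Adj
    by unfold_locales (use assms in auto)
  \<comment> \<open>Arc length along the ray. It is finite at \<open>0\<close> under the growth condition on \<open>\<Psi>\<close>.\<close>
  obtain W where W: "\<And>r. r > 0 \<Longrightarrow> (W has_real_derivative speed r) (at r)"
    using antiderivative_on_halfline[OF speed_continuous] by blast
  have incomplete: "incomplete_metric_space (ray g0) (path_dist A (GP A P) (ray g0)) \<and>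
      (ray_totally_geodesic A P Adj g0 \<longrightarrow> geodesically_incomplete A P Adj)"
    if "\<alpha> > - real CARD('n) / 2" "\<Psi> \<in> O[at_right 0](\<lambda>r. r powr \<alpha>)" for \<alpha>
  proof -
    have conv: "convergent (\<lambda>k. W (1 / real (Suc k)))"
      by (rule speed_antiderivative_convergent[OF that W])
    show ?thesis
      using Metric_space_ray not_mcomplete_ray[OF W conv] ray_geodesically_incomplete[OF _ W conv]
      unfolding incomplete_metric_space_def by blast
  qed
  have "ray_totally_geodesic A P Adj g0 \<longleftrightarrow>
      (\<forall>g\<in>ray g0. \<forall>h\<in>line g0. \<forall>m\<in>sym_fields A.
        normal_to_ray A g0 g m \<longrightarrow> normal_to_ray A g0 g (dir_deriv A P g m h))"
    unfolding totally_geodesic_iff normal_condition_iff by (rule refl)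
  with length_of_ray incomplete show ?thesis by blast
qed

end
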